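(* Let $\Gamma$ be a connected tropical curve of genus $g$ admitting a model whose graph has no separating edges. There is a canonical isomorphism of real tori $$\mathrm{Jac}(\Gamma)\cong\mathrm{JH}_{1,0}(\Gamma)$$ between the Jacobian of $\Gamma$ and its tropical intermediate Jacobian, and, under this isomorphism, the classical tropical Abel--Jacobi map $\mathrm{Div}_0(\Gamma)\to\mathrm{Jac}(\Gamma)$ corresponds to the Abel--Jacobi map $\mathrm{AJ}\colon\mathrm{Div}_0(\Gamma)=\mathcal Z_0^\circ(\Gamma)\to\mathrm{JH}_{1,0}(\Gamma)$; that is, the diagram with rows these two maps, left vertical arrow the identity of $\mathrm{Div}_0(\Gamma)$ and right vertical arrow the isomorphism $\mathrm{Jac}(\Gamma)\cong\mathrm{JH}_{1,0}(\Gamma)$ commutes.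
   Context: A tropical curve $\Gamma$ here is a compact connected metric graph, given by a model $(G,\ell)$: a finite graph $G=(V,E)$ and an edge-length function $\ell\colon E\to\mathbb R_{>0}$. The genus is the first Betti number. Orient all edges; $s_e$, $t_e$ are the source and target of $e$. $\mathrm{Div}_0(\Gamma)$ is the group of degree-$0$ divisors (finite formal $\mathbb Z$-combinations of points of $\Gamma$ with total coefficient $0$); it equals the group $\mathcal Z^\circ_0(\Gamma)$ of homologically trivial $0$-cycles. **Jacobian.** $\Omega_{\mathbb Z}$ is the group of integral harmonic $1$-forms: functions $\omega\colon E\to\mathbb Z$ with $\sum_{s_e=v}\omega(e)=\sum_{t_e=v}\omega(e)$ for all $v\in V$; $\Omega=\Omega_{\mathbb Z}\otimes\mathbb R$. For a path (or 1-chain) $\gamma$ in $\Gamma$, $\mathbf I_\gamma\in\Omega^\vee$ is $\omega\mapsto\int_\gamma\omega$; thus $\mathbf I_e(\omega)=\ell(e)\omega(e)$. The map $\gamma\mapsto\mathbf I_\gamma$ embeds $\mathrm H_1(\Gamma,\mathbb Z)$ as a full-rank lattice in $\Omega^\vee$, and $\mathrm{Jac}(\Gamma)=\Omega^\vee/\mathrm H_1(\Gamma,\mathbb Z)$. The classical tropical Abel--Jacobi map sends $D\in\mathrm{Div}_0(\Gamma)$ to the class of $\mathbf I_\gamma$ where $\gamma$ is any integral $1$-chain with boundary $D$ (so $y-x\mapsto\mathbf I_\gamma$ for $\gamma$ a path from $x$ to $y$). **Intermediate Jacobian.** The tropical coefficients are $\mathbf F_0^{\mathbb Z}(e)=\mathbf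 F_0^{\mathbb Z}(v)=\mathbb Z$, $\mathbf F_1^{\mathbb Z}(e)=\mathbb Z\cdot 1_e$ with $1_e$ the unit tangent vector of $e$, and $\mathbf F^{\mathbb Z}_1(v)=\big(\bigoplus_{e\ni v}\mathbb Z1_e\big)/\langle\sum_{e\ni v}\mathrm{sgn}(e,v)1_e\rangle$, with $\mathrm{sgn}(e,s_e)=1$, $\mathrm{sgn}(e,t_e)=-1$ (loops contributing one term for each end); $\mathbf F_p=\mathbf F_p^{\mathbb Z}\otimes\mathbb R$. Let $\mathrm C_{p,1}=\bigoplus_e\mathbf F_p(e)$, $\mathrm C_{p,0}=\bigoplus_v\mathbf F_p(v)$ (integral version with $\mathbf F_p^{\mathbb Z}$), $\partial[e,u]=\sum_{v}\mathrm{sgn}(e,v)[v,u]$, sum over the endpoints; $\mathrm H_{p,q}(\Gamma,\cdot)$ is the homology. The monodromy is $\mathrm N([e,1])=\sum_v\mathrm{sgn}(e,v)[v,o_e-o_v]$, where $o_e$ is the midpoint of $e$, $o_v=v$ and $o_e-o_v$ is the tangent vector along $e$ from $v$ to the midpoint. It induces $\mathrm N\colon\mathrm H_{0,1}(\Gamma,\mathbb Z)\to\mathrm H_{1,0}(\Gamma,\mathbb R)$, and $\mathrm{JH}_{1,0}(\Gamma)=\mathrm H_{1,0}(\Gamma,\mathbb R)/\mathrm N(\mathrm H_{0,1}(\Gamma,\mathbb Z))$. For $D\in\mathrm{Div}_0(\Gamma)$ (refine the model so that $D$ is supported on vertices), $\mathrm{AJ}(D)$ is the class in $\mathrm{JH}_{1,0}(\Gamma)$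 of $\mathrm N(\gamma)$ for any $\gamma\in\mathrm C_{0,1}(\Gamma,\mathbb Z)$ with $\partial\gamma=D$. *)

theory Defs
  imports
    "Graph_Theory.Digraph_Component"
    "HOL-Algebra.Product_Groups"
    "HOL-Algebra.Free_Abelian_Groups"
    "HOL-Analysis.Function_Topology"
begin

section \<open>Tropical curves, refinements, divisors\<close>

text \<open>
  A model is a finite digraph (loops and parallel arcs allowed; the direction of an arc is the
  chosen orientation, the tail is the source and the head the target) with an edge-length function.
\<close>

definition tropical_curve :: "('v,'e) pre_digraph \<Rightarrow> ('e \<Rightarrow> real) \<Rightarrow> bool" where
  "tropical_curve G len \<longleftrightarrow>
     fin_digraph G \<and> Digraph_Component.connected G \<and> (\<forall>e\<in>arcs G. len e > 0)"

definition separating_edge :: "('v,'e) pre_digraph \<Rightarrow> 'e \<Rightarrow> bool" where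
  "separating_edge G e \<longleftrightarrow>
     e \<in> arcs G \<and> \<not> Digraph_Component.connected (pre_digraph.del_arc G e)"

text \<open>\<open>Interior e t\<close> is the point of the open edge \<open>e\<close> at distance \<open>t\<close> from its source.\<close>

datatype ('v,'e) point = Vertex 'v | Interior 'e real

definition curve_points :: "('v,'e) pre_digraph \<Rightarrow> ('e \<Rightarrow> real) \<Rightarrow> ('v,'e) point set" where
  "curve_points G len = Vertex ` verts G \<union> {Interior e t | e t. e \<in> arcs G \<and> 0 < t \<and> t < len e}"

definition point_at :: "('v,'e) pre_digraph \<Rightarrow> ('e \<Rightarrow> real) \<Rightarrow> 'e \<Rightarrow> real \<Rightarrow> ('v,'e) point" where
  "point_at G len e t =
     (if t = 0 then Vertex (tail G e) else if t = len e then Vertex (head G e) else Interior e t)"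

text \<open>
  The model obtained from \<open>(G, len)\<close> by subdividing at a finite set \<open>S\<close> of interior points. The
  arc \<open>(e, a, b)\<close> is the segment of \<open>e\<close> between the consecutive division points at distances
  \<open>a < b\<close> from the source of \<open>e\<close>.
\<close>

definition division_points :: "('e \<Rightarrow> real) \<Rightarrow> ('v,'e) point set \<Rightarrow> 'e \<Rightarrow> real set" where
  "division_points len S e = {0, len e} \<union> {t. Interior e t \<in> S}"

definition refine ::
  "('v,'e) pre_digraph \<Rightarrow> ('e \<Rightarrow> real) \<Rightarrow> ('v,'e) point set \<Rightarrow>
     (('v,'e) point, 'e \<times> real \<times> real) pre_digraph" where
  "refine G len S =
     \<lparr> verts = Vertex ` verts G \<union> {Interior e t | e t. Interior e t \<in> S},
       arcs = {(e, a, b) | e a b. e \<in> arcs G \<and> a \<in> division_points len S e \<and>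
                 b \<in> division_points len S e \<and> a < b \<and>
                 (\<forall>c\<in>division_points len S e. \<not> (a < c \<and> c < b))},
       tail = (\<lambda>(e, a, b). point_at G len e a),
       head = (\<lambda>(e, a, b). point_at G len e b) \<rparr>"

definition refine_len :: "'e \<times> real \<times> real \<Rightarrow> real" where
  "refine_len = (\<lambda>(e, a, b). b - a)"

definition Div0 :: "('v,'e) pre_digraph \<Rightarrow> ('e \<Rightarrow> real) \<Rightarrow> (('v,'e) point \<Rightarrow>\<^sub>0 int) set" where
  "Div0 G len = {D \<in> carrier (free_Abelian_group (curve_points G len)).
     (\<Sum>x\<in>Poly_Mapping.keys D. Poly_Mapping.lookup D x) = 0}"


section \<open>Integral 1-chains and 1-cycles\<close>

definition C01 :: "('v,'e) pre_digraph \<Rightarrow> ('e \<Rightarrow>\<^sub>0 int) monoid" where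
  "C01 G = free_Abelian_group (arcs G)"

definition C00 :: "('v,'e) pre_digraph \<Rightarrow> ('v \<Rightarrow>\<^sub>0 int) monoid" where
  "C00 G = free_Abelian_group (verts G)"

text \<open>
  The boundary of the tropical chain complex uses \<open>sgn(e, s\<^sub>e) = 1\<close>, \<open>sgn(e, t\<^sub>e) = -1\<close>, so that
  \<open>\<partial>[e,1] = [s\<^sub>e,1] - [t\<^sub>e,1]\<close>. This is the opposite of the boundary of \<open>e\<close> viewed as a path from
  \<open>s\<^sub>e\<close> to \<open>t\<^sub>e\<close>, which is the one used for the classical Abel--Jacobi map.
\<close>

definition bd0 :: "('v,'e) pre_digraph \<Rightarrow> ('e \<Rightarrow>\<^sub>0 int) \<Rightarrow> ('v \<Rightarrow>\<^sub>0 int)" where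
  "bd0 G = frag_extend (\<lambda>e. frag_of (tail G e) - frag_of (head G e))"

definition path_bd :: "('v,'e) pre_digraph \<Rightarrow> ('e \<Rightarrow>\<^sub>0 int) \<Rightarrow> ('v \<Rightarrow>\<^sub>0 int)" where
  "path_bd G = frag_extend (\<lambda>e. frag_of (head G e) - frag_of (tail G e))"

text \<open>There are no 2-chains, so this kernel is both \<open>H\<^sub>1(\<Gamma>, \<int>)\<close> and \<open>H\<^sub>0\<^sub>,\<^sub>1(\<Gamma>, \<int>)\<close>.\<close>

definition H01 :: "('v,'e) pre_digraph \<Rightarrow> ('e \<Rightarrow>\<^sub>0 int) set" where
  "H01 G = kernel (C01 G) (C00 G) (bd0 G)"

text \<open>The first Betti number: the rank of \<open>H\<^sub>1(\<Gamma>, \<int>)\<close>.\<close>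

definition genus :: "('v,'e) pre_digraph \<Rightarrow> nat" where
  "genus G = (GREATEST n. \<exists>B. B \<subseteq> H01 G \<and> finite B \<and> card B = n \<and>
     (\<forall>c. (\<Sum>\<gamma>\<in>B. frag_cmul (c \<gamma>) \<gamma>) = 0 \<longrightarrow> (\<forall>\<gamma>\<in>B. c \<gamma> = 0)))"


section \<open>Quotient topologies\<close>

definition real_group :: "real monoid" where
  "real_group = \<lparr>carrier = UNIV, monoid.mult = (+), one = 0\<rparr>"

definition quot_topology :: "'a topology \<Rightarrow> ('a \<Rightarrow> 'b) \<Rightarrow> 'b topology" where
  "quot_topology X q =
     topology (\<lambda>U. U \<subseteq> q ` topspace X \<and> openin X {x \<in> topspace X. q x \<in> U})"

lemma openin_quot_topology:
  "openin (quot_topology X q) U \<longleftrightarrow>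
     U \<subseteq> q ` topspace X \<and> openin X {x \<in> topspace X. q x \<in> U}"
proof -
  have "istopology (\<lambda>U. U \<subseteq> q ` topspace X \<and> openin X {x \<in> topspace X. q x \<in> U})"
    unfolding istopology_def
  proof (intro conjI allI impI)
    fix S T
    assume "S \<subseteq> q ` topspace X \<and> openin X {x \<in> topspace X. q x \<in> S}"
      and "T \<subseteq> q ` topspace X \<and> openin X {x \<in> topspace X. q x \<in> T}"
    moreover have "{x \<in> topspace X. q x \<in> S \<inter> T} =
        {x \<in> topspace X. q x \<in> S} \<inter> {x \<in> topspace X. q x \<in> T}"
      by auto
    ultimately show "openin X {x \<in> topspace X. q x \<in> S \<inter> T}" and "S \<inter> T \<subseteq> q ` topspace X"
      by auto
  next
    fix K
    assume K: "\<forall>U\<in>K. U \<subseteq> q ` topspace X \<and> openin X {x \<in> topspace X. q x \<in> U}"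
    have "{x \<in> topspace X. q x \<in> \<Union>K} = (\<Union>U\<in>K. {x \<in> topspace X. q x \<in> U})"
      by auto
    with K show "openin X {x \<in> topspace X. q x \<in> \<Union>K}"
      by auto
    from K show "\<Union>K \<subseteq> q ` topspace X"
      by blast
  qed
  then show ?thesis
    unfolding quot_topology_def by simp
qed

lemma topspace_quot_topology: "topspace (quot_topology X q) = q ` topspace X"
proof -
  have "{x \<in> topspace X. q x \<in> q ` topspace X} = topspace X"
    by auto
  then have "openin (quot_topology X q) (q ` topspace X)"
    by (simp add: openin_quot_topology)
  then show ?thesis
    by (metis openin_quot_topology openin_subset openin_topspace subset_antisym)
qed

lemma quotient_map_quot_topology: "quotient_map X (quot_topology X q) q"
  by (auto simp: quotient_map_def topspace_quot_topology openin_quot_topology)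


section \<open>The Jacobian\<close>

definition OmegaZ :: "('v,'e) pre_digraph \<Rightarrow> ('e \<Rightarrow> int) set" where
  "OmegaZ G = {\<omega> \<in> arcs G \<rightarrow>\<^sub>E UNIV. \<forall>v\<in>verts G.
     (\<Sum>e | e \<in> arcs G \<and> tail G e = v. \<omega> e) = (\<Sum>e | e \<in> arcs G \<and> head G e = v. \<omega> e)}"

text \<open>\<open>\<Omega> = \<Omega>\<^sub>\<int> \<otimes> \<real>\<close> is realised as the real span of \<open>\<Omega>\<^sub>\<int>\<close> in the space of functions \<open>E \<rightarrow> \<real>\<close>.\<close>

definition Omega :: "('v,'e) pre_digraph \<Rightarrow> ('e \<Rightarrow> real) set" where
  "Omega G = {(\<lambda>e\<in>arcs G. \<Sum>\<eta>\<in>B. c \<eta> * real_of_int (\<eta> e)) | B c. finite B \<and> B \<subseteq> OmegaZ G}"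

definition Omega_dual_carrier :: "('v,'e) pre_digraph \<Rightarrow> (('e \<Rightarrow> real) \<Rightarrow> real) set" where
  "Omega_dual_carrier G = {F \<in> Omega G \<rightarrow>\<^sub>E UNIV. \<forall>\<omega>\<in>Omega G. \<forall>\<eta>\<in>Omega G. \<forall>a b.
     F (\<lambda>e\<in>arcs G. a * \<omega> e + b * \<eta> e) = a * F \<omega> + b * F \<eta>}"

definition Omega_dual :: "('v,'e) pre_digraph \<Rightarrow> (('e \<Rightarrow> real) \<Rightarrow> real) monoid" where
  "Omega_dual G = (product_group (Omega G) (\<lambda>_. real_group))\<lparr>carrier := Omega_dual_carrier G\<rparr>"

text \<open>
  \<open>\<Omega>\<close> is finite-dimensional, so the topology of pointwise convergence is the vector space
  topology of its dual.
\<close>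

definition Omega_dual_topology :: "('v,'e) pre_digraph \<Rightarrow> (('e \<Rightarrow> real) \<Rightarrow> real) topology" where
  "Omega_dual_topology G =
     subtopology (product_topology (\<lambda>_. euclideanreal) (Omega G)) (Omega_dual_carrier G)"

definition integral1 ::
  "('v,'e) pre_digraph \<Rightarrow> ('e \<Rightarrow> real) \<Rightarrow> ('e \<Rightarrow>\<^sub>0 int) \<Rightarrow> ('e \<Rightarrow> real) \<Rightarrow> real" where
  "integral1 G len \<gamma> \<omega> = (\<Sum>e\<in>arcs G. real_of_int (Poly_Mapping.lookup \<gamma> e) * (len e * \<omega> e))"

definition period_lattice ::
  "('v,'e) pre_digraph \<Rightarrow> ('e \<Rightarrow> real) \<Rightarrow> (('e \<Rightarrow> real) \<Rightarrow> real) set" where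
  "period_lattice G len = (\<lambda>\<gamma>. \<lambda>\<omega>\<in>Omega G. integral1 G len \<gamma> \<omega>) ` H01 G"

definition Jac :: "('v,'e) pre_digraph \<Rightarrow> ('e \<Rightarrow> real) \<Rightarrow> (('e \<Rightarrow> real) \<Rightarrow> real) set monoid" where
  "Jac G len = Omega_dual G Mod period_lattice G len"

definition Jac_class ::
  "('v,'e) pre_digraph \<Rightarrow> ('e \<Rightarrow> real) \<Rightarrow> (('e \<Rightarrow> real) \<Rightarrow> real) \<Rightarrow> (('e \<Rightarrow> real) \<Rightarrow> real) set" where
  "Jac_class G len F = period_lattice G len #>\<^bsub>Omega_dual G\<^esub> F"

definition Jac_topology ::
  "('v,'e) pre_digraph \<Rightarrow> ('e \<Rightarrow> real) \<Rightarrow> (('e \<Rightarrow> real) \<Rightarrow> real) set topology" where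
  "Jac_topology G len = quot_topology (Omega_dual_topology G) (Jac_class G len)"

text \<open>
  A 1-chain with boundary \<open>D\<close> lives on the refinement at the support of \<open>D\<close>; a harmonic form
  \<open>\<omega>\<close> of \<open>G\<close> takes the value \<open>\<omega> e\<close> on each segment \<open>(e, a, b)\<close> of \<open>e\<close>.
\<close>

definition classical_AJ ::
  "('v,'e) pre_digraph \<Rightarrow> ('e \<Rightarrow> real) \<Rightarrow> (('v,'e) point \<Rightarrow>\<^sub>0 int) \<Rightarrow>
     (('e \<Rightarrow> real) \<Rightarrow> real) set" where
  "classical_AJ G len D =
     (let G' = refine G len (Poly_Mapping.keys D) in
      THE c. \<exists>\<gamma>\<in>carrier (C01 G'). path_bd G' \<gamma> = D \<and>
        c = Jac_class G len (\<lambda>\<omega>\<in>Omega G. integral1 G' refine_len \<gamma> (\<omega> \<circ> fst)))"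


section \<open>The tropical intermediate Jacobian\<close>

text \<open>
  An end of an edge is a pair of the edge and one of its two sides; a loop has two ends at its
  vertex. The unit tangent vector \<open>1\<^sub>e\<close> (pointing from source to target) at an end is the
  corresponding basis vector of the space of real functions on the ends at \<open>v\<close>.
\<close>

datatype side = Source | Target

fun side_sgn :: "side \<Rightarrow> real" where
  "side_sgn Source = 1"
| "side_sgn Target = -1"

definition ends_at :: "('v,'e) pre_digraph \<Rightarrow> 'v \<Rightarrow> ('e \<times> side) set" where
  "ends_at G v = {(e, Source) | e. e \<in> arcs G \<and> tail G e = v} \<union>
                 {(e, Target) | e. e \<in> arcs G \<and> head G e = v}"

definition tangents :: "('v,'e) pre_digraph \<Rightarrow> 'v \<Rightarrow> ('e \<times> side \<Rightarrow> real) monoid" where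
  "tangents G v = product_group (ends_at G v) (\<lambda>_. real_group)"

definition balancing_line :: "('v,'e) pre_digraph \<Rightarrow> 'v \<Rightarrow> ('e \<times> side \<Rightarrow> real) set" where
  "balancing_line G v = range (\<lambda>r. \<lambda>h\<in>ends_at G v. r * side_sgn (snd h))"

definition F1 :: "('v,'e) pre_digraph \<Rightarrow> 'v \<Rightarrow> ('e \<times> side \<Rightarrow> real) set monoid" where
  "F1 G v = tangents G v Mod balancing_line G v"

definition F1_class ::
  "('v,'e) pre_digraph \<Rightarrow> 'v \<Rightarrow> ('e \<times> side \<Rightarrow> real) \<Rightarrow> ('e \<times> side \<Rightarrow> real) set" where
  "F1_class G v x = balancing_line G v #>\<^bsub>tangents G v\<^esub> x"

definition F1_topology ::
  "('v,'e) pre_digraph \<Rightarrow> 'v \<Rightarrow> ('e \<times> side \<Rightarrow> real) set topology" where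
  "F1_topology G v =
     quot_topology (product_topology (\<lambda>_. euclideanreal) (ends_at G v)) (F1_class G v)"

text \<open>The graph is finite, so the direct sums of the chain complex are products.\<close>

definition C11 :: "('v,'e) pre_digraph \<Rightarrow> ('e \<Rightarrow> real) monoid" where
  "C11 G = product_group (arcs G) (\<lambda>_. real_group)"

definition C10 :: "('v,'e) pre_digraph \<Rightarrow> ('v \<Rightarrow> ('e \<times> side \<Rightarrow> real) set) monoid" where
  "C10 G = product_group (verts G) (F1 G)"

text \<open>\<open>\<partial>[e, 1\<^sub>e] = \<Sum> sgn(e,v) [v, 1\<^sub>e]\<close>, the sum running over the two ends of \<open>e\<close>.\<close>

definition bd1 ::
  "('v,'e) pre_digraph \<Rightarrow> ('e \<Rightarrow> real) \<Rightarrow> ('v \<Rightarrow> ('e \<times> side \<Rightarrow> real) set)" where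
  "bd1 G u = (\<lambda>v\<in>verts G. F1_class G v (\<lambda>h\<in>ends_at G v. side_sgn (snd h) * u (fst h)))"

definition H10 :: "('v,'e) pre_digraph \<Rightarrow> ('v \<Rightarrow> ('e \<times> side \<Rightarrow> real) set) set monoid" where
  "H10 G = C10 G Mod (bd1 G ` carrier (C11 G))"

definition H10_class ::
  "('v,'e) pre_digraph \<Rightarrow> ('v \<Rightarrow> ('e \<times> side \<Rightarrow> real) set) \<Rightarrow>
     ('v \<Rightarrow> ('e \<times> side \<Rightarrow> real) set) set" where
  "H10_class G X = (bd1 G ` carrier (C11 G)) #>\<^bsub>C10 G\<^esub> X"

text \<open>
  The vector \<open>o\<^sub>e - o\<^sub>v\<close> from an end of \<open>e\<close> to the midpoint of \<open>e\<close>, as a multiple of \<open>1\<^sub>e\<close>.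
\<close>

definition to_midpoint :: "('e \<Rightarrow> real) \<Rightarrow> 'e \<times> side \<Rightarrow> real" where
  "to_midpoint len h = side_sgn (snd h) * (len (fst h) / 2)"

definition monodromy ::
  "('v,'e) pre_digraph \<Rightarrow> ('e \<Rightarrow> real) \<Rightarrow> ('e \<Rightarrow>\<^sub>0 int) \<Rightarrow>
     ('v \<Rightarrow> ('e \<times> side \<Rightarrow> real) set)" where
  "monodromy G len \<gamma> = (\<lambda>v\<in>verts G. F1_class G v (\<lambda>h\<in>ends_at G v.
     real_of_int (Poly_Mapping.lookup \<gamma> (fst h)) * (side_sgn (snd h) * to_midpoint len h)))"

definition monodromy_lattice ::
  "('v,'e) pre_digraph \<Rightarrow> ('e \<Rightarrow> real) \<Rightarrow> ('v \<Rightarrow> ('e \<times> side \<Rightarrow> real) set) set set" where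
  "monodromy_lattice G len = (\<lambda>\<gamma>. H10_class G (monodromy G len \<gamma>)) ` H01 G"

definition JH10 ::
  "('v,'e) pre_digraph \<Rightarrow> ('e \<Rightarrow> real) \<Rightarrow> ('v \<Rightarrow> ('e \<times> side \<Rightarrow> real) set) set set monoid" where
  "JH10 G len = H10 G Mod monodromy_lattice G len"

definition JH10_class ::
  "('v,'e) pre_digraph \<Rightarrow> ('e \<Rightarrow> real) \<Rightarrow> ('v \<Rightarrow> ('e \<times> side \<Rightarrow> real) set) \<Rightarrow>
     ('v \<Rightarrow> ('e \<times> side \<Rightarrow> real) set) set set" where
  "JH10_class G len X = monodromy_lattice G len #>\<^bsub>H10 G\<^esub> H10_class G X"

text \<open>The successive quotient topologies starting from the real tangent spaces at the vertices.\<close>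

definition JH10_topology ::
  "('v,'e) pre_digraph \<Rightarrow> ('e \<Rightarrow> real) \<Rightarrow>
     ('v \<Rightarrow> ('e \<times> side \<Rightarrow> real) set) set set topology" where
  "JH10_topology G len =
     quot_topology
       (quot_topology (product_topology (F1_topology G) (verts G)) (H10_class G))
       (\<lambda>c. monodromy_lattice G len #>\<^bsub>H10 G\<^esub> c)"

text \<open>
  The chain map \<open>C\<^sub>1\<^sub>,\<^sub>0(G) \<rightarrow> C\<^sub>1\<^sub>,\<^sub>0(G')\<close> to the refinement \<open>G'\<close> at \<open>S\<close>: an end \<open>((e, a, b), d)\<close> of
  \<open>G'\<close> at an old vertex lies along the end \<open>(e, d)\<close> of \<open>G\<close> and has the same tangent vector, so
  \<open>F\<^sub>1\<close> at an old vertex is unchanged (cosets are mapped to cosets); the components at the new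
  vertices are zero. It induces the identification of \<open>JH\<^sub>1\<^sub>,\<^sub>0\<close> of the two models.
\<close>

definition refine_C10 ::
  "('v,'e) pre_digraph \<Rightarrow> ('e \<Rightarrow> real) \<Rightarrow> ('v,'e) point set \<Rightarrow>
     ('v \<Rightarrow> ('e \<times> side \<Rightarrow> real) set) \<Rightarrow>
     (('v,'e) point \<Rightarrow> (('e \<times> real \<times> real) \<times> side \<Rightarrow> real) set)" where
  "refine_C10 G len S X =
     (let G' = refine G len S in
      (\<lambda>p\<in>verts G'. case p of
          Vertex v \<Rightarrow> (\<lambda>x. \<lambda>h\<in>ends_at G' p. x (fst (fst h), snd h)) ` X v
        | Interior e t \<Rightarrow> \<one>\<^bsub>F1 G' p\<^esub>))"

text \<open>
  \<open>AJ(D)\<close> is the class in \<open>JH\<^sub>1\<^sub>,\<^sub>0\<close> of the model \<open>G\<close> that corresponds to the class of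
  \<open>N(\<gamma>)\<close>, \<open>\<partial>\<gamma> = D\<close>, in \<open>JH\<^sub>1\<^sub>,\<^sub>0\<close> of the refinement at the support of \<open>D\<close>.
\<close>

definition AJ ::
  "('v,'e) pre_digraph \<Rightarrow> ('e \<Rightarrow> real) \<Rightarrow> (('v,'e) point \<Rightarrow>\<^sub>0 int) \<Rightarrow>
     ('v \<Rightarrow> ('e \<times> side \<Rightarrow> real) set) set set" where
  "AJ G len D =
     (let S = Poly_Mapping.keys D; G' = refine G len S in
      THE c. \<exists>X\<in>carrier (C10 G). \<exists>\<gamma>\<in>carrier (C01 G'). bd0 G' \<gamma> = D \<and>
        c = JH10_class G len X \<and>
        JH10_class G' refine_len (refine_C10 G len S X) =
          JH10_class G' refine_len (monodromy G' refine_len \<gamma>))"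

end

theory Submission
  imports Defs
begin

text \<open>
  A chain in \<open>C\<^sub>1\<^sub>,\<^sub>0\<close> is given by a real number at each end of each
  edge (\<open>chain_class\<close>). The balancing lines change these numbers by a potential on the
  vertices, and the boundary of \<open>[e, u]\<close> moves \<open>u\<close> from one end of
  \<open>e\<close> to the other. So the only thing that survives in
  \<open>H\<^sub>1\<^sub>,\<^sub>0\<close> is the vector in \<open>\<real>\<^sup>E\<close> whose
  entry at \<open>e\<close> is the sum over the two ends of \<open>e\<close>, modulo the gradients
  \<open>f(s\<^sub>e) - f(t\<^sub>e)\<close> of functions \<open>f\<close> on the vertices. On the
  other side, each vector \<open>c\<close> in \<open>\<real>\<^sup>E\<close> defines the linear form
  \<open>\<omega> \<mapsto> \<Sum> c(e) \<omega>(e)\<close> on \<open>\<Omega>\<close>; every linear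
  form arises in this way, and two vectors define the same form exactly if they differ by a gradient
  (\<open>Omega_dual_eq_functional\<close>, \<open>functional_eq_iff\<close>). Hence
  \<open>H\<^sub>1\<^sub>,\<^sub>0 \<cong> \<Omega>\<^sup>\<or>\<close>
  (\<open>H10_class_eq_iff\<close>). The monodromy puts half of the length of \<open>e\<close> at
  either end of \<open>e\<close>, with the same sign at both, so that \<open>N(\<gamma>)\<close>
  corresponds to \<open>I\<^sub>\<gamma>\<close>; the two lattices correspond, and the quotients are
  isomorphic.

  All facts about \<open>\<Omega>\<close> come from fundamental cycles: connectedness gives a chain
  \<open>\<gamma>\<^sub>v\<close> from a base vertex to each vertex \<open>v\<close>, the chain
  \<open>z\<^sub>e = e + \<gamma>\<^sub>s - \<gamma>\<^sub>t\<close> is a cycle, and a harmonic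
  \<open>\<omega>\<close> is the combination \<open>\<Sum> \<omega>(e) z\<^sub>e\<close>. The
  coordinates \<open>F(z\<^sub>e)\<close> of a linear form \<open>F\<close> are continuous in
  \<open>F\<close>, and so are the values of the form attached to a chain; since both tori carry
  quotient topologies, the isomorphism and its inverse are continuous.

  For a divisor \<open>D\<close> the two Abel--Jacobi maps live on the refinement at the support of
  \<open>D\<close>. A harmonic function on the refinement is constant along each old edge, hence a
  pullback (\<open>harmonic_refine_descends\<close>), and summing over the segments of an edge
  transports linear forms, lattices and classes between the two models. The boundary of
  \<open>C\<^sub>0\<^sub>,\<^sub>1\<close> is the negative of the boundary of paths, so the tropical
  map integrates along the negative of the classical chain. This is why the isomorphism used below
  is the negative of the identification described above.

  It is the only map that commutes with the Abel--Jacobi maps because the classical one is onto: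
  moving \<open>n\<close> points from the source of \<open>e\<close> by the distance
  \<open>t\<close> contributes \<open>n t\<close> to the coordinate \<open>e\<close>, and every real
  number has this form with \<open>0 < t < len e\<close> (\<open>classical_AJ_surj\<close>).
\<close>

section \<open>Harmonic functions and cycles\<close>

text \<open>
  Coefficients in any commutative monoid, so that the notion covers integral 1-cycles, integral
  forms and real forms alike.
\<close>

definition harmonic :: "('v,'e) pre_digraph \<Rightarrow> ('e \<Rightarrow> 'a::comm_monoid_add) \<Rightarrow> bool" where
  "harmonic G f \<longleftrightarrow> (\<forall>v\<in>verts G.
     (\<Sum>e | e \<in> arcs G \<and> tail G e = v. f e) = (\<Sum>e | e \<in> arcs G \<and> head G e = v. f e))"

lemma harmonic_cong:
  assumes "\<And>e. e \<in> arcs G \<Longrightarrow> f e = g e"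
  shows "harmonic G f \<longleftrightarrow> harmonic G g"
proof -
  have "(\<Sum>e | e \<in> arcs G \<and> w e = v. f e) = (\<Sum>e | e \<in> arcs G \<and> w e = v. g e)" for w :: "_ \<Rightarrow> 'b" and v
    using assms by (intro sum.cong) auto
  then show ?thesis
    by (simp add: harmonic_def)
qed

lemma harmonic_of_int:
  "harmonic G (\<lambda>e. of_int (f e) :: 'a::ring_char_0) \<longleftrightarrow> harmonic G f"
  unfolding harmonic_def of_int_sum[symmetric] of_int_eq_iff ..

lemma (in fin_digraph) sum_arcs_by_parts:
  fixes f :: "'b \<Rightarrow> 'c::comm_ring_1"
  shows "(\<Sum>e\<in>arcs G. f e * (g (head G e) - g (tail G e))) =
    (\<Sum>v\<in>verts G. ((\<Sum>e | e \<in> arcs G \<and> head G e = v. f e) -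
                       (\<Sum>e | e \<in> arcs G \<and> tail G e = v. f e)) * g v)"
proof -
  have "(\<Sum>e\<in>arcs G. f e * g (w e)) = (\<Sum>v\<in>verts G. (\<Sum>e | e \<in> arcs G \<and> w e = v. f e) * g v)"
    if "w ` arcs G \<subseteq> verts G" for w
    by (subst sum.group[OF finite_arcs finite_verts that, symmetric])
       (auto simp: sum_distrib_right intro!: sum.cong)
  moreover have "head G ` arcs G \<subseteq> verts G" "tail G ` arcs G \<subseteq> verts G"
    by auto
  ultimately show ?thesis
    by (simp add: right_diff_distrib left_diff_distrib sum_subtractf)
qed

text \<open>
  Summation by parts moves the difference operator from the potential to \<open>f\<close>. In this
  form the passage to a refinement is a telescoping sum, and no bookkeeping of the edges at a vertex
  is needed.
\<close>

lemma (in fin_digraph) harmonic_iff_orthogonal_to_gradients: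
  fixes f :: "'b \<Rightarrow> 'c::comm_ring_1"
  shows "harmonic G f \<longleftrightarrow> (\<forall>g. (\<Sum>e\<in>arcs G. f e * (g (head G e) - g (tail G e))) = 0)"
proof
  assume "harmonic G f"
  then show "\<forall>g. (\<Sum>e\<in>arcs G. f e * (g (head G e) - g (tail G e))) = 0"
    by (simp add: sum_arcs_by_parts harmonic_def)
next
  assume R: "\<forall>g. (\<Sum>e\<in>arcs G. f e * (g (head G e) - g (tail G e))) = 0"
  show "harmonic G f"
    unfolding harmonic_def
  proof
    fix v assume v: "v \<in> verts G"
    from R[rule_format, of "\<lambda>w. if w = v then 1 else 0"] v
    show "(\<Sum>e | e \<in> arcs G \<and> tail G e = v. f e) = (\<Sum>e | e \<in> arcs G \<and> head G e = v. f e)"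
      unfolding sum_arcs_by_parts[of f "\<lambda>w. if w = v then 1 else 0"]
      by (simp add: finite_verts if_distrib[of "\<lambda>x. _ * x"] cong: if_cong)
  qed
qed

lemma sum_lookup_frag_of:
  "finite A \<Longrightarrow> x \<in> A \<Longrightarrow>
    (\<Sum>e\<in>A. of_int (Poly_Mapping.lookup (frag_of x) e) * f e) = (f x :: 'a::ring_1)"
  by (simp add: if_distrib[of of_int] if_distrib[of "\<lambda>x. x * _"] cong: if_cong)

lemma lookup_frag_extend:
  assumes "finite A" "Poly_Mapping.keys \<gamma> \<subseteq> A"
  shows "Poly_Mapping.lookup (frag_extend b \<gamma>) v =
    (\<Sum>e\<in>A. Poly_Mapping.lookup \<gamma> e * Poly_Mapping.lookup (b e) v)"
proof -
  have "(\<Sum>e\<in>Poly_Mapping.keys \<gamma>. Poly_Mapping.lookup \<gamma> e * Poly_Mapping.lookup (b e) v) =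
      (\<Sum>e\<in>A. Poly_Mapping.lookup \<gamma> e * Poly_Mapping.lookup (b e) v)"
    using assms by (intro sum.mono_neutral_left) (auto simp: in_keys_iff)
  then show ?thesis
    by (simp add: frag_extend_def lookup_sum)
qed

lemma carrier_C01: "carrier (C01 G) = {\<gamma>. Poly_Mapping.keys \<gamma> \<subseteq> arcs G}"
  by (auto simp: C01_def)

lemma carrier_C01_iff: "\<gamma> \<in> carrier (C01 G) \<longleftrightarrow> Poly_Mapping.keys \<gamma> \<subseteq> arcs G"
  by (simp add: carrier_C01)

lemma bd0_eq: "bd0 G \<gamma> = - path_bd G \<gamma>"
  by (rule poly_mapping_eqI)
     (simp add: bd0_def path_bd_def frag_extend_def lookup_sum lookup_minus sum_negf[symmetric] algebra_simps)

lemma path_bd_add: "path_bd G (x + y) = path_bd G x + path_bd G y"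
  and path_bd_diff: "path_bd G (x - y) = path_bd G x - path_bd G y"
  and path_bd_minus: "path_bd G (- x) = - path_bd G x"
  and path_bd_cmul: "path_bd G (frag_cmul c x) = frag_cmul c (path_bd G x)"
  and path_bd_of: "path_bd G (frag_of e) = frag_of (head G e) - frag_of (tail G e)"
  and path_bd_zero: "path_bd G 0 = 0"
  by (simp_all add: path_bd_def frag_extend_add frag_extend_diff frag_extend_minus frag_extend_cmul)

lemma path_bd_sum: "finite I \<Longrightarrow> path_bd G (sum x I) = (\<Sum>i\<in>I. path_bd G (x i))"
  by (simp add: path_bd_def frag_extend_sum)

lemma (in fin_digraph) lookup_path_bd:
  assumes "\<gamma> \<in> carrier (C01 G)"
  shows "Poly_Mapping.lookup (path_bd G \<gamma>) v =
    (\<Sum>e | e \<in> arcs G \<and> head G e = v. Poly_Mapping.lookup \<gamma> e) -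
    (\<Sum>e | e \<in> arcs G \<and> tail G e = v. Poly_Mapping.lookup \<gamma> e)"
proof -
  have "Poly_Mapping.lookup (path_bd G \<gamma>) v =
      (\<Sum>e\<in>arcs G. Poly_Mapping.lookup \<gamma> e * (if v = head G e then 1 else 0)) -
      (\<Sum>e\<in>arcs G. Poly_Mapping.lookup \<gamma> e * (if v = tail G e then 1 else 0))"
    using assms
    by (simp add: path_bd_def carrier_C01 lookup_frag_extend[OF finite_arcs] lookup_minus
        lookup_frag_of right_diff_distrib sum_subtractf)
  moreover have "(\<Sum>e\<in>arcs G. Poly_Mapping.lookup \<gamma> e * (if v = w e then 1 else 0)) =
      (\<Sum>e | e \<in> arcs G \<and> w e = v. Poly_Mapping.lookup \<gamma> e)" for w
    by (subst sum.inter_filter[OF finite_arcs]) (auto intro!: sum.cong)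
  ultimately show ?thesis
    by simp
qed

lemma (in fin_digraph) path_bd_eq_0_iff:
  assumes "\<gamma> \<in> carrier (C01 G)"
  shows "path_bd G \<gamma> = 0 \<longleftrightarrow> harmonic G (Poly_Mapping.lookup \<gamma>)"
proof
  assume "path_bd G \<gamma> = 0"
  then have "Poly_Mapping.lookup (path_bd G \<gamma>) v = 0" for v
    by simp
  then show "harmonic G (Poly_Mapping.lookup \<gamma>)"
    by (simp add: lookup_path_bd[OF assms] harmonic_def)
next
  assume H: "harmonic G (Poly_Mapping.lookup \<gamma>)"
  show "path_bd G \<gamma> = 0"
  proof (rule poly_mapping_eqI)
    fix v
    show "Poly_Mapping.lookup (path_bd G \<gamma>) v = Poly_Mapping.lookup 0 v"
    proof (cases "v \<in> verts G")
      case True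
      then show ?thesis
        using H by (simp add: lookup_path_bd[OF assms] harmonic_def)
    next
      case False
      then have "{e \<in> arcs G. head G e = v} = {}" "{e \<in> arcs G. tail G e = v} = {}"
        by auto
      then show ?thesis
        by (simp only: lookup_path_bd[OF assms] sum.empty lookup_zero diff_self)
    qed
  qed
qed

lemma path_bd_closed:
  assumes "wf_digraph G" "\<gamma> \<in> carrier (C01 G)"
  shows "Poly_Mapping.keys (path_bd G \<gamma>) \<subseteq> verts G"
  unfolding path_bd_def
proof (rule order_trans[OF keys_frag_extend])
  have "Poly_Mapping.keys (frag_of (head G e) - frag_of (tail G e)) \<subseteq> verts G" if "e \<in> arcs G" for e
    using keys_diff[of "frag_of (head G e)" "frag_of (tail G e)"] that
      wf_digraph.head_in_verts[OF assms(1) that] wf_digraph.tail_in_verts[OF assms(1) that]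
    by auto
  then show "(\<Union>e\<in>Poly_Mapping.keys \<gamma>. Poly_Mapping.keys (frag_of (head G e) - frag_of (tail G e))) \<subseteq> verts G"
    using assms(2) by (auto simp: carrier_C01)
qed

lemma (in fin_digraph) H01_iff:
  "\<gamma> \<in> H01 G \<longleftrightarrow> \<gamma> \<in> carrier (C01 G) \<and> harmonic G (Poly_Mapping.lookup \<gamma>)"
proof -
  have "\<gamma> \<in> H01 G \<longleftrightarrow> \<gamma> \<in> carrier (C01 G) \<and> path_bd G \<gamma> = 0"
    by (auto simp: H01_def kernel_def bd0_eq C00_def)
  then show ?thesis
    using path_bd_eq_0_iff by auto
qed

lemma OmegaZ_iff: "\<omega> \<in> OmegaZ G \<longleftrightarrow> \<omega> \<in> arcs G \<rightarrow>\<^sub>E UNIV \<and> harmonic G \<omega>"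
  by (simp add: OmegaZ_def harmonic_def)

text \<open>
  Connectedness in the form in which it is used: any two vertices bound an integral 1-chain.
\<close>

locale chain_connected = fin_digraph G for G :: "('v,'e) pre_digraph" +
  assumes chain_exists: "u \<in> verts G \<Longrightarrow> v \<in> verts G \<Longrightarrow>
    \<exists>\<gamma>\<in>carrier (C01 G). path_bd G \<gamma> = frag_of v - frag_of u"
begin

definition base_vertex :: 'v where
  "base_vertex = (SOME v. v \<in> verts G)"

text \<open>
  A choice of a chain from the base vertex to each vertex plays the role of a spanning tree.
\<close>

definition base_chain :: "'v \<Rightarrow> 'e \<Rightarrow>\<^sub>0 int" where
  "base_chain v = (SOME \<gamma>. \<gamma> \<in> carrier (C01 G) \<and> path_bd G \<gamma> = frag_of v - frag_of base_vertex)"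

definition fundamental_cycle :: "'e \<Rightarrow> 'e \<Rightarrow>\<^sub>0 int" where
  "fundamental_cycle e = frag_of e + base_chain (tail G e) - base_chain (head G e)"

definition fundamental_form :: "'e \<Rightarrow> 'e \<Rightarrow> real" where
  "fundamental_form e = (\<lambda>x\<in>arcs G. of_int (Poly_Mapping.lookup (fundamental_cycle e) x))"

lemma
  assumes "v \<in> verts G"
  shows base_chain_closed: "base_chain v \<in> carrier (C01 G)"
    and path_bd_base_chain: "path_bd G (base_chain v) = frag_of v - frag_of base_vertex"
proof -
  have "base_vertex \<in> verts G"
    unfolding base_vertex_def using assms by (rule someI)
  then have "\<exists>\<gamma>. \<gamma> \<in> carrier (C01 G) \<and> path_bd G \<gamma> = frag_of v - frag_of base_vertex"
    using chain_exists assms by blast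
  from someI_ex[OF this] show "base_chain v \<in> carrier (C01 G)"
    "path_bd G (base_chain v) = frag_of v - frag_of base_vertex"
    by (simp_all add: base_chain_def)
qed

lemma fundamental_cycle_in_H01:
  assumes "e \<in> arcs G"
  shows "fundamental_cycle e \<in> H01 G"
proof -
  have "frag_of e \<in> carrier (C01 G)"
    using assms by (simp add: C01_def)
  then have "fundamental_cycle e \<in> carrier (C01 G)"
    using base_chain_closed[OF head_in_verts[OF assms]] base_chain_closed[OF tail_in_verts[OF assms]]
    unfolding fundamental_cycle_def carrier_C01
    by (metis (no_types, lifting) keys_add keys_diff Un_subset_iff mem_Collect_eq subset_trans)
  moreover have "path_bd G (fundamental_cycle e) = 0"
    using assms by (simp add: fundamental_cycle_def path_bd_diff path_bd_add path_bd_of path_bd_base_chain)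
  ultimately show ?thesis
    by (simp add: H01_iff path_bd_eq_0_iff)
qed

lemma harmonic_fundamental_form: "e \<in> arcs G \<Longrightarrow> harmonic G (fundamental_form e)"
  using fundamental_cycle_in_H01[of e] harmonic_of_int[where 'a=real, of G "Poly_Mapping.lookup (fundamental_cycle e)"]
  by (simp add: H01_iff fundamental_form_def cong: harmonic_cong)

text \<open>
  The sum of \<open>\<omega>(e) z\<^sub>e\<close> differs from the chain \<open>\<Sum> \<omega>(e)
  e\<close> by a combination of the base chains whose coefficients are the divergences of
  \<open>\<omega>\<close>, and these vanish.
\<close>

lemma sum_fundamental_form:
  fixes \<omega> :: "'e \<Rightarrow> real"
  assumes "harmonic G \<omega>" and "x \<in> arcs G"
  shows "(\<Sum>e\<in>arcs G. \<omega> e * fundamental_form e x) = \<omega> x"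
proof -
  let ?g = "\<lambda>v. real_of_int (Poly_Mapping.lookup (base_chain v) x)"
  have "(\<Sum>e\<in>arcs G. \<omega> e * fundamental_form e x) =
      (\<Sum>e\<in>arcs G. \<omega> e * (if e = x then 1 else 0)) - (\<Sum>e\<in>arcs G. \<omega> e * (?g (head G e) - ?g (tail G e)))"
    unfolding sum_subtractf[symmetric] using assms(2)
    by (intro sum.cong)
       (auto simp: fundamental_form_def fundamental_cycle_def lookup_add lookup_minus lookup_frag_of algebra_simps)
  also have "\<dots> = \<omega> x"
    using assms harmonic_iff_orthogonal_to_gradients[of \<omega>, THEN iffD1, THEN spec, of ?g]
    by (simp add: if_distrib[of "\<lambda>x. _ * x"] cong: if_cong)
  finally show ?thesis .
qed

text \<open>
  A real harmonic form is the real combination of the integral fundamental forms with its own values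
  as coefficients, hence lies in the span of the integral forms.
\<close>

lemma Omega_iff: "\<omega> \<in> Omega G \<longleftrightarrow> \<omega> \<in> extensional (arcs G) \<and> harmonic G \<omega>"
proof
  assume "\<omega> \<in> Omega G"
  then obtain B c where B: "finite B" "B \<subseteq> OmegaZ G"
    and \<omega>: "\<omega> = (\<lambda>e\<in>arcs G. \<Sum>\<eta>\<in>B. c \<eta> * real_of_int (\<eta> e))"
    by (auto simp: Omega_def)
  have "(\<Sum>e\<in>arcs G. \<omega> e * (g (head G e) - g (tail G e))) = 0" for g
  proof -
    have "(\<Sum>e\<in>arcs G. \<omega> e * (g (head G e) - g (tail G e))) =
        (\<Sum>\<eta>\<in>B. c \<eta> * (\<Sum>e\<in>arcs G. of_int (\<eta> e) * (g (head G e) - g (tail G e))))"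
      unfolding \<omega> sum_distrib_left
      by (subst sum.swap) (auto intro!: sum.cong simp: sum_distrib_left sum_distrib_right mult_ac)
    also have "\<dots> = 0"
    proof (intro sum.neutral ballI)
      fix \<eta> assume "\<eta> \<in> B"
      then have "harmonic G (\<lambda>e. real_of_int (\<eta> e))"
        using B by (auto simp: OmegaZ_iff harmonic_of_int)
      then show "c \<eta> * (\<Sum>e\<in>arcs G. of_int (\<eta> e) * (g (head G e) - g (tail G e))) = 0"
        by (simp add: harmonic_iff_orthogonal_to_gradients)
    qed
    finally show ?thesis .
  qed
  then have "harmonic G \<omega>"
    by (simp add: harmonic_iff_orthogonal_to_gradients)
  then show "\<omega> \<in> extensional (arcs G) \<and> harmonic G \<omega>"
    by (simp add: \<omega>)
next
  assume \<omega>: "\<omega> \<in> extensional (arcs G) \<and> harmonic G \<omega>"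
  let ?z = "\<lambda>e. \<lambda>x\<in>arcs G. Poly_Mapping.lookup (fundamental_cycle e) x"
  let ?c = "\<lambda>\<eta>. \<Sum>e | e \<in> arcs G \<and> ?z e = \<eta>. \<omega> e"
  have z: "?z ` arcs G \<subseteq> OmegaZ G"
    using fundamental_cycle_in_H01 by (auto simp: OmegaZ_iff H01_iff cong: harmonic_cong)
  have "\<omega> = (\<lambda>x\<in>arcs G. \<Sum>\<eta>\<in>?z ` arcs G. ?c \<eta> * real_of_int (\<eta> x))"
  proof (rule extensionalityI[of _ "arcs G"])
    fix x assume x: "x \<in> arcs G"
    have "\<omega> x = (\<Sum>e\<in>arcs G. \<omega> e * real_of_int (?z e x))"
      using sum_fundamental_form[of \<omega> x] \<omega> x by (simp add: fundamental_form_def)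
    also have "\<dots> = (\<Sum>\<eta>\<in>?z ` arcs G. \<Sum>e | e \<in> arcs G \<and> ?z e = \<eta>. \<omega> e * real_of_int (?z e x))"
      by (subst sum.group) auto
    also have "\<dots> = (\<Sum>\<eta>\<in>?z ` arcs G. ?c \<eta> * real_of_int (\<eta> x))"
      unfolding sum_distrib_right by (intro sum.cong refl) auto
    finally show "\<omega> x = (\<lambda>x\<in>arcs G. \<Sum>\<eta>\<in>?z ` arcs G. ?c \<eta> * real_of_int (\<eta> x)) x"
      using x by simp
  qed (use \<omega> in auto)
  moreover have "finite (?z ` arcs G)"
    by simp
  ultimately show "\<omega> \<in> Omega G"
    unfolding Omega_def using z by (intro CollectI exI[of _ "?z ` arcs G"] exI[of _ ?c] conjI)
qed

lemma fundamental_form_in_Omega: "e \<in> arcs G \<Longrightarrow> fundamental_form e \<in> Omega G"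
  by (simp add: Omega_iff harmonic_fundamental_form) (simp add: fundamental_form_def)

text \<open>
  The potential at \<open>v\<close> is the integral of \<open>c\<close> along the base chain of
  \<open>v\<close>, up to sign; orthogonality to the fundamental cycle of \<open>e\<close> says that
  it has the right difference along \<open>e\<close>.
\<close>

lemma gradient_if_orthogonal_to_Omega:
  fixes c :: "'e \<Rightarrow> real"
  assumes "\<And>\<omega>. \<omega> \<in> Omega G \<Longrightarrow> (\<Sum>e\<in>arcs G. c e * \<omega> e) = 0"
  obtains f where "\<And>e. e \<in> arcs G \<Longrightarrow> c e = f (tail G e) - f (head G e)"
proof
  fix e assume e: "e \<in> arcs G"
  let ?f = "\<lambda>v. - (\<Sum>x\<in>arcs G. of_int (Poly_Mapping.lookup (base_chain v) x) * c x)"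
  have "0 = (\<Sum>x\<in>arcs G. c x * fundamental_form e x)"
    using assms fundamental_form_in_Omega[OF e] by simp
  also have "\<dots> = (\<Sum>x\<in>arcs G. of_int (Poly_Mapping.lookup (frag_of e) x) * c x) -
      ?f (tail G e) + ?f (head G e)"
    by (simp add: fundamental_form_def fundamental_cycle_def lookup_add lookup_minus algebra_simps
        sum.distrib sum_subtractf)
  finally show "c e = ?f (tail G e) - ?f (head G e)"
    using sum_lookup_frag_of[OF finite_arcs e, of c] by simp
qed

end

lemma (in fin_digraph) chain_along_walk:
  assumes "v \<rightarrow>\<^sup>*\<^bsub>mk_symmetric G\<^esub> w"
  shows "\<exists>\<gamma>\<in>carrier (C01 G). path_bd G \<gamma> = frag_of w - frag_of v"
proof -
  interpret S: pair_fin_digraph "mk_symmetric G" ..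
  from assms show ?thesis
  proof (induction rule: S.reachable_induct)
    case base
    then show ?case
      by (intro bexI[of _ 0]) (auto simp: path_bd_zero C01_def)
  next
    case (step u w)
    then obtain \<gamma> where \<gamma>: "\<gamma> \<in> carrier (C01 G)" "path_bd G \<gamma> = frag_of u - frag_of v"
      by blast
    from step obtain e where e: "e \<in> arcs G"
      "(tail G e = u \<and> head G e = w) \<or> (tail G e = w \<and> head G e = u)"
      by (auto simp: parcs_mk_symmetric)
    define \<sigma> where "\<sigma> = (if tail G e = u then frag_of e else - frag_of e)"
    have "path_bd G \<sigma> = frag_of w - frag_of u"
      using e(2) by (auto simp: \<sigma>_def path_bd_of path_bd_minus)
    then have "path_bd G (\<gamma> + \<sigma>) = frag_of w - frag_of v"
      using \<gamma> by (simp add: path_bd_add)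
    moreover have "\<gamma> + \<sigma> \<in> carrier (C01 G)"
      using \<gamma> e(1) keys_add[of \<gamma> \<sigma>] by (auto simp: carrier_C01 \<sigma>_def split: if_splits)
    ultimately show ?case
      by blast
  qed
qed

lemma chain_connected_if_tropical_curve:
  assumes "tropical_curve G len"
  shows "chain_connected G"
proof -
  interpret fin_digraph G
    using assms by (simp add: tropical_curve_def)
  have "strongly_connected (with_proj (mk_symmetric G))"
    using assms by (simp add: tropical_curve_def connected_def)
  then have "u \<rightarrow>\<^sup>*\<^bsub>mk_symmetric G\<^esub> v" if "u \<in> verts G" "v \<in> verts G" for u v
    using that by (auto simp: strongly_connected_def )
  then show ?thesis
    by unfold_locales (blast intro: chain_along_walk)
qed

section \<open>The Jacobian in coordinates\<close>

lemma group_real_group: "group real_group"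
  by (rule groupI) (auto simp: real_group_def intro: exI[of _ "- _"])

lemma real_group_simps [simp]:
  "carrier real_group = UNIV" "x \<otimes>\<^bsub>real_group\<^esub> y = x + y" "\<one>\<^bsub>real_group\<^esub> = 0"
  by (simp_all add: real_group_def)

lemma comm_group_product_group:
  assumes "\<And>i. i \<in> I \<Longrightarrow> comm_group (A i)"
  shows "comm_group (product_group I A)"
proof (rule group.group_comm_groupI)
  show "group (product_group I A)"
    using assms by (simp add: comm_group_def)
  show "x \<otimes>\<^bsub>product_group I A\<^esub> y = y \<otimes>\<^bsub>product_group I A\<^esub> x"
    if "x \<in> carrier (product_group I A)" "y \<in> carrier (product_group I A)" for x y
    using that assms by (auto simp: PiE_iff comm_groupE(4) intro!: restrict_ext)
qed

lemma comm_group_real_group: "comm_group real_group"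
  by (rule group.group_comm_groupI[OF group_real_group]) simp

text \<open>
  Decides equality of classes in the Jacobian, in \<open>H\<^sub>1\<^sub>,\<^sub>0\<close> and in
  the intermediate Jacobian.
\<close>

lemma (in comm_group) r_coset_eq_iff:
  assumes "subgroup B G" "x \<in> carrier G" "y \<in> carrier G"
  shows "B #> x = B #> y \<longleftrightarrow> (\<exists>b\<in>B. x = b \<otimes> y)"
proof
  assume "B #> x = B #> y"
  then have "x \<in> B #> y"
    using rcos_self[OF assms(2,1)] by simp
  then show "\<exists>b\<in>B. x = b \<otimes> y"
    by (auto simp: r_coset_def)
next
  assume "\<exists>b\<in>B. x = b \<otimes> y"
  then have "x \<in> B #> y"
    by (auto simp: r_coset_def)
  from repr_independence[OF this assms(3,1)] show "B #> x = B #> y" ..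
qed

lemma (in fin_digraph) subgroup_H01: "subgroup (H01 G) (C01 G)"
proof -
  have "bd0 G \<in> hom (C01 G) (C00 G)"
  proof (rule homI)
    show "bd0 G x \<in> carrier (C00 G)" if "x \<in> carrier (C01 G)" for x
      using path_bd_closed[OF wf_digraph_axioms that] by (simp add: C00_def bd0_eq)
  qed (simp add: C01_def C00_def bd0_def frag_extend_add)
  then interpret group_hom "C01 G" "C00 G" "bd0 G"
    by (intro group_hom.intro group_hom_axioms.intro) (simp_all add: C01_def C00_def)
  show ?thesis
    unfolding H01_def by (rule subgroup_kernel)
qed

text \<open>
  Every linear form on \<open>\<Omega>\<close> is of this kind, so that
  \<open>\<real>\<^sup>E\<close> supplies (redundant) coordinates on the dual.
\<close>

definition functional :: "('v,'e) pre_digraph \<Rightarrow> ('e \<Rightarrow> real) \<Rightarrow> ('e \<Rightarrow> real) \<Rightarrow> real" where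
  "functional G c = (\<lambda>\<omega>\<in>Omega G. \<Sum>e\<in>arcs G. c e * \<omega> e)"

text \<open>
  The coordinates of the integration form \<open>I\<^sub>\<gamma>\<close>.
\<close>

abbreviation period_vector :: "('e \<Rightarrow> real) \<Rightarrow> ('e \<Rightarrow>\<^sub>0 int) \<Rightarrow> 'e \<Rightarrow> real" where
  "period_vector len \<gamma> \<equiv> \<lambda>e. real_of_int (Poly_Mapping.lookup \<gamma> e) * len e"

lemma functional_cong: "(\<And>e. e \<in> arcs G \<Longrightarrow> c e = d e) \<Longrightarrow> functional G c = functional G d"
  by (simp add: functional_def cong: sum.cong)

lemma functional_eq_on_Omega:
  "functional G c = functional G d \<longleftrightarrow>
    (\<forall>\<omega>\<in>Omega G. (\<Sum>e\<in>arcs G. c e * \<omega> e) = (\<Sum>e\<in>arcs G. d e * \<omega> e))"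
  unfolding functional_def by (auto simp: fun_eq_iff restrict_def)

lemma integral1_eq_functional:
  "(\<lambda>\<omega>\<in>Omega G. integral1 G len \<gamma> \<omega>) = functional G (period_vector len \<gamma>)"
  by (simp add: functional_def integral1_def mult_ac)

lemma period_lattice_eq: "period_lattice G len = (\<lambda>\<gamma>. functional G (period_vector len \<gamma>)) ` H01 G"
  by (simp add: period_lattice_def integral1_eq_functional)

lemma mult_Omega_dual: "x \<otimes>\<^bsub>Omega_dual G\<^esub> y = (\<lambda>\<omega>\<in>Omega G. x \<omega> + y \<omega>)"
  by (simp add: Omega_dual_def)

lemma carrier_Omega_dual: "carrier (Omega_dual G) = Omega_dual_carrier G"
  by (simp add: Omega_dual_def)

lemma one_Omega_dual: "\<one>\<^bsub>Omega_dual G\<^esub> = functional G (\<lambda>_. 0)"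
  by (simp add: Omega_dual_def functional_def)

lemma functional_mult:
  "functional G c \<otimes>\<^bsub>Omega_dual G\<^esub> functional G d = functional G (\<lambda>e. c e + d e)"
  by (auto simp: mult_Omega_dual functional_def algebra_simps sum.distrib intro!: restrict_ext)

context chain_connected
begin

lemma Omega_combination:
  assumes "\<omega> \<in> Omega G" "\<eta> \<in> Omega G"
  shows "(\<lambda>e\<in>arcs G. a * \<omega> e + b * \<eta> e) \<in> Omega G"
  using assms
  by (auto simp: Omega_iff harmonic_def sum.distrib sum_distrib_left[symmetric] cong: harmonic_cong)

lemma zero_in_Omega: "(\<lambda>e\<in>arcs G. 0) \<in> Omega G"
  by (auto simp: Omega_iff harmonic_def)

lemma functional_closed: "functional G c \<in> Omega_dual_carrier G"
  unfolding Omega_dual_carrier_def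
proof (intro CollectI conjI ballI allI)
  show "functional G c \<in> Omega G \<rightarrow>\<^sub>E UNIV"
    by (simp add: functional_def)
  fix \<omega> \<eta> a b assume "\<omega> \<in> Omega G" "\<eta> \<in> Omega G"
  then show "functional G c (\<lambda>e\<in>arcs G. a * \<omega> e + b * \<eta> e) = a * functional G c \<omega> + b * functional G c \<eta>"
    by (simp add: functional_def Omega_combination algebra_simps sum.distrib sum_distrib_left)
qed

text \<open>
  Apply \<open>F\<close> to the expansion of \<open>\<omega>\<close> in fundamental forms. The
  values of \<open>F\<close> on these forms are coordinates that depend continuously on
  \<open>F\<close>.
\<close>

lemma Omega_dual_eq_functional:
  assumes "F \<in> Omega_dual_carrier G"
  shows "F = functional G (\<lambda>e. F (fundamental_form e))"
proof -
  have lin: "F (\<lambda>e\<in>arcs G. a * \<omega> e + b * \<eta> e) = a * F \<omega> + b * F \<eta>"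
    if "\<omega> \<in> Omega G" "\<eta> \<in> Omega G" for \<omega> \<eta> a b
    using assms that by (auto simp: Omega_dual_carrier_def)
  have sums: "(\<lambda>x\<in>arcs G. \<Sum>e\<in>A. c e * fundamental_form e x) \<in> Omega G \<and>
      F (\<lambda>x\<in>arcs G. \<Sum>e\<in>A. c e * fundamental_form e x) = (\<Sum>e\<in>A. c e * F (fundamental_form e))"
    if "finite A" "A \<subseteq> arcs G" for A c
    using that
  proof (induction A rule: finite_induct)
    case empty
    have "F (\<lambda>e\<in>arcs G. 0) = 0"
      using lin[OF zero_in_Omega zero_in_Omega, of 0 0] by simp
    then show ?case
      unfolding sum.empty using zero_in_Omega by blast
  next
    case (insert e A)
    let ?s = "\<lambda>x\<in>arcs G. \<Sum>e\<in>A. c e * fundamental_form e x"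
    have IH: "?s \<in> Omega G" "F ?s = (\<Sum>e\<in>A. c e * F (fundamental_form e))"
      using insert.IH insert.prems by blast+
    have z: "fundamental_form e \<in> Omega G"
      using insert.prems fundamental_form_in_Omega by auto
    have eq: "(\<lambda>x\<in>arcs G. \<Sum>e\<in>insert e A. c e * fundamental_form e x) =
        (\<lambda>x\<in>arcs G. c e * fundamental_form e x + 1 * ?s x)"
      using insert.hyps by (auto intro!: restrict_ext)
    show ?case
      unfolding eq
    proof
      show "(\<lambda>x\<in>arcs G. c e * fundamental_form e x + 1 * ?s x) \<in> Omega G"
        by (rule Omega_combination[OF z IH(1)])
      show "F (\<lambda>x\<in>arcs G. c e * fundamental_form e x + 1 * ?s x) =
          (\<Sum>e\<in>insert e A. c e * F (fundamental_form e))"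
        unfolding lin[OF z IH(1)] IH(2) using insert.hyps by simp
    qed
  qed
  show ?thesis
  proof (rule extensionalityI[of _ "Omega G"])
    fix \<omega> assume \<omega>: "\<omega> \<in> Omega G"
    have "(\<lambda>x\<in>arcs G. \<Sum>e\<in>arcs G. \<omega> e * fundamental_form e x) = \<omega>"
      using \<omega> by (intro extensionalityI[of _ "arcs G"]) (auto simp: Omega_iff sum_fundamental_form)
    then show "F \<omega> = functional G (\<lambda>e. F (fundamental_form e)) \<omega>"
      using sums[of "arcs G" \<omega>] \<omega> by (simp add: functional_def mult.commute)
  qed (use assms in \<open>auto simp: Omega_dual_carrier_def functional_def PiE_def\<close>)
qed

lemma Omega_dual_cases:
  assumes "F \<in> carrier (Omega_dual G)"
  obtains c where "F = functional G c"
  using assms Omega_dual_eq_functional by (auto simp: carrier_Omega_dual)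

lemma functional_in_carrier [simp]: "functional G c \<in> carrier (Omega_dual G)"
  by (simp add: carrier_Omega_dual functional_closed)

lemma comm_group_Omega_dual: "comm_group (Omega_dual G)"
proof (rule comm_groupI)
  fix x y z
  assume "x \<in> carrier (Omega_dual G)" "y \<in> carrier (Omega_dual G)" "z \<in> carrier (Omega_dual G)"
  then show "x \<otimes>\<^bsub>Omega_dual G\<^esub> y \<otimes>\<^bsub>Omega_dual G\<^esub> z = x \<otimes>\<^bsub>Omega_dual G\<^esub> (y \<otimes>\<^bsub>Omega_dual G\<^esub> z)"
    by (elim Omega_dual_cases) (simp add: functional_mult add.assoc)
next
  fix x y
  assume "x \<in> carrier (Omega_dual G)" "y \<in> carrier (Omega_dual G)"
  then show "x \<otimes>\<^bsub>Omega_dual G\<^esub> y \<in> carrier (Omega_dual G)"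
    "x \<otimes>\<^bsub>Omega_dual G\<^esub> y = y \<otimes>\<^bsub>Omega_dual G\<^esub> x"
    by (elim Omega_dual_cases; simp add: functional_mult add.commute)+
next
  fix x
  assume "x \<in> carrier (Omega_dual G)"
  then obtain c where c: "x = functional G c"
    by (rule Omega_dual_cases)
  then show "\<one>\<^bsub>Omega_dual G\<^esub> \<otimes>\<^bsub>Omega_dual G\<^esub> x = x"
    by (simp add: one_Omega_dual functional_mult)
  show "\<exists>y\<in>carrier (Omega_dual G). y \<otimes>\<^bsub>Omega_dual G\<^esub> x = \<one>\<^bsub>Omega_dual G\<^esub>"
    by (rule bexI[of _ "functional G (\<lambda>e. - c e)"]) (simp_all add: c one_Omega_dual functional_mult)
qed (simp add: one_Omega_dual)

text \<open>
  The difference \<open>c - d\<close> is orthogonal to \<open>\<Omega>\<close>, and the orthogonal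
  complement of the harmonic functions is the space of gradients.
\<close>

lemma functional_eq_iff:
  "functional G c = functional G d \<longleftrightarrow>
    (\<exists>f. \<forall>e\<in>arcs G. c e - d e = f (tail G e) - f (head G e))"
proof
  assume "functional G c = functional G d"
  then have "(\<Sum>e\<in>arcs G. (c e - d e) * \<omega> e) = 0" if "\<omega> \<in> Omega G" for \<omega>
    using that by (simp add: functional_eq_on_Omega left_diff_distrib sum_subtractf)
  from gradient_if_orthogonal_to_Omega[OF this]
  show "\<exists>f. \<forall>e\<in>arcs G. c e - d e = f (tail G e) - f (head G e)"
    by metis
next
  assume "\<exists>f. \<forall>e\<in>arcs G. c e - d e = f (tail G e) - f (head G e)"
  then obtain f where "\<forall>e\<in>arcs G. c e - d e = f (tail G e) - f (head G e)" ..
  then have f: "c e = d e - (f (head G e) - f (tail G e))" if "e \<in> arcs G" for e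
    using bspec[OF _ that] by force
  have "(\<Sum>e\<in>arcs G. c e * \<omega> e) = (\<Sum>e\<in>arcs G. d e * \<omega> e)" if "\<omega> \<in> Omega G" for \<omega>
  proof -
    have "(\<Sum>e\<in>arcs G. \<omega> e * (f (head G e) - f (tail G e))) = 0"
      using that by (simp add: Omega_iff harmonic_iff_orthogonal_to_gradients)
    moreover have "(\<Sum>e\<in>arcs G. c e * \<omega> e) =
        (\<Sum>e\<in>arcs G. d e * \<omega> e - \<omega> e * (f (head G e) - f (tail G e)))"
      by (intro sum.cong refl) (simp add: f algebra_simps)
    ultimately show ?thesis
      by (simp add: sum_subtractf)
  qed
  then show "functional G c = functional G d"
    by (simp add: functional_eq_on_Omega)
qed

lemma subgroup_period_lattice: "subgroup (period_lattice G len) (Omega_dual G)"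
proof -
  interpret D: comm_group "Omega_dual G"
    by (rule comm_group_Omega_dual)
  interpret group_hom "C01 G" "Omega_dual G" "\<lambda>\<gamma>. functional G (period_vector len \<gamma>)"
    by (intro group_hom.intro group_hom_axioms.intro homI)
       (simp_all add: C01_def D.is_group functional_mult lookup_add algebra_simps)
  show ?thesis
    unfolding period_lattice_eq by (rule subgroup_img_is_subgroup[OF subgroup_H01])
qed

lemma Jac_class_eq_iff:
  "Jac_class G len (functional G c) = Jac_class G len (functional G d) \<longleftrightarrow>
    (\<exists>\<gamma>\<in>H01 G. functional G c = functional G (\<lambda>e. period_vector len \<gamma> e + d e))"
  unfolding Jac_class_def
  using comm_group.r_coset_eq_iff[OF comm_group_Omega_dual subgroup_period_lattice]
  by (simp add: period_lattice_eq functional_mult)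

lemma carrier_Jac: "carrier (Jac G len) = Jac_class G len ` carrier (Omega_dual G)"
  by (simp add: Jac_def Jac_class_def[abs_def] carrier_FactGroup)

end

section \<open>The intermediate Jacobian in coordinates\<close>

text \<open>
  Each end belongs to one vertex only, so a single function on all ends represents an element of the
  whole product \<open>C\<^sub>1\<^sub>,\<^sub>0\<close>.
\<close>

definition chain_class ::
  "('v,'e) pre_digraph \<Rightarrow> ('e \<times> side \<Rightarrow> real) \<Rightarrow> 'v \<Rightarrow> ('e \<times> side \<Rightarrow> real) set" where
  "chain_class G y = (\<lambda>v\<in>verts G. F1_class G v (restrict y (ends_at G v)))"

definition end_sum :: "('e \<times> side \<Rightarrow> real) \<Rightarrow> 'e \<Rightarrow> real" where
  "end_sum y e = y (e, Source) + y (e, Target)"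

lemma F1_class_eq:
  "F1_class G v x = range (\<lambda>r. \<lambda>h\<in>ends_at G v. r * side_sgn (snd h) + x h)"
  by (auto simp: F1_class_def balancing_line_def r_coset_def tangents_def intro!: restrict_ext)

lemma F1_class_eq_iff:
  "F1_class G v x = F1_class G v x' \<longleftrightarrow>
    (\<exists>r. \<forall>h\<in>ends_at G v. x h = r * side_sgn (snd h) + x' h)"
proof
  assume "F1_class G v x = F1_class G v x'"
  moreover have "restrict x (ends_at G v) \<in> F1_class G v x"
    unfolding F1_class_eq by (auto intro!: range_eqI[of _ _ 0] restrict_ext)
  ultimately obtain r where
    r: "restrict x (ends_at G v) = (\<lambda>h\<in>ends_at G v. r * side_sgn (snd h) + x' h)"
    unfolding F1_class_eq by auto
  have "x h = r * side_sgn (snd h) + x' h" if "h \<in> ends_at G v" for h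
    using fun_cong[OF r, of h] that by simp
  then show "\<exists>r. \<forall>h\<in>ends_at G v. x h = r * side_sgn (snd h) + x' h"
    by blast
next
  assume "\<exists>r. \<forall>h\<in>ends_at G v. x h = r * side_sgn (snd h) + x' h"
  then obtain r where r: "\<And>h. h \<in> ends_at G v \<Longrightarrow> x h = r * side_sgn (snd h) + x' h"
    by blast
  let ?a = "\<lambda>s. \<lambda>h\<in>ends_at G v. s * side_sgn (snd h) + x h"
  let ?b = "\<lambda>s. \<lambda>h\<in>ends_at G v. s * side_sgn (snd h) + x' h"
  have shift: "?a s = ?b (s + r)" "?b s = ?a (s - r)" for s
    by (auto simp: r algebra_simps intro!: restrict_ext)
  have "range ?a = range ?b"
    by (intro subset_antisym image_subsetI; subst shift; rule rangeI)
  then show "F1_class G v x = F1_class G v x'"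
    by (simp add: F1_class_eq)
qed

lemma comm_group_tangents: "comm_group (tangents G v)"
  unfolding tangents_def by (intro comm_group_product_group comm_group_real_group)

lemma carrier_tangents: "carrier (tangents G v) = (ends_at G v \<rightarrow>\<^sub>E UNIV)"
  by (simp add: tangents_def)

lemma mult_tangents: "x \<otimes>\<^bsub>tangents G v\<^esub> y = (\<lambda>h\<in>ends_at G v. x h + y h)"
  by (simp add: tangents_def)

lemma subgroup_balancing_line: "subgroup (balancing_line G v) (tangents G v)"
proof -
  interpret group_hom real_group "tangents G v" "\<lambda>r. \<lambda>h\<in>ends_at G v. r * side_sgn (snd h)"
    using comm_group_tangents[of G v]
    by (intro group_hom.intro group_hom_axioms.intro homI)
       (auto simp: group_real_group comm_group_def carrier_tangents mult_tangents distrib_right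
         intro!: restrict_ext)
  show ?thesis
    using img_is_subgroup by (simp add: balancing_line_def)
qed

lemma comm_group_F1: "comm_group (F1 G v)"
  unfolding F1_def by (rule comm_group.abelian_FactGroup[OF comm_group_tangents subgroup_balancing_line])

lemma carrier_F1: "carrier (F1 G v) = F1_class G v ` (ends_at G v \<rightarrow>\<^sub>E UNIV)"
  by (simp add: F1_def F1_class_def[abs_def] carrier_FactGroup carrier_tangents)

lemma F1_class_mult:
  assumes "x \<in> ends_at G v \<rightarrow>\<^sub>E UNIV" "y \<in> ends_at G v \<rightarrow>\<^sub>E UNIV"
  shows "F1_class G v x \<otimes>\<^bsub>F1 G v\<^esub> F1_class G v y = F1_class G v (\<lambda>h\<in>ends_at G v. x h + y h)"
proof -
  interpret normal "balancing_line G v" "tangents G v"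
    by (rule comm_group.subgroup_imp_normal[OF comm_group_tangents subgroup_balancing_line])
  show ?thesis
    using rcos_sum[of x y] assms by (simp add: F1_def F1_class_def carrier_tangents mult_tangents)
qed

lemma comm_group_C10: "comm_group (C10 G)"
  unfolding C10_def by (intro comm_group_product_group comm_group_F1)

lemma chain_class_closed [simp]: "chain_class G y \<in> carrier (C10 G)"
  by (auto simp: chain_class_def C10_def carrier_F1)

lemma chain_class_mult:
  "chain_class G x \<otimes>\<^bsub>C10 G\<^esub> chain_class G y = chain_class G (\<lambda>h. x h + y h)"
proof -
  have "F1_class G v (\<lambda>h\<in>ends_at G v. restrict x (ends_at G v) h + restrict y (ends_at G v) h) =
      F1_class G v (\<lambda>h\<in>ends_at G v. x h + y h)" for v
    by (intro arg_cong[of _ _ "F1_class G v"] restrict_ext) simp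
  then show ?thesis
    by (simp add: C10_def chain_class_def F1_class_mult cong: restrict_cong)
qed

lemma (in wf_digraph) ends_at_iff:
  "(e, d) \<in> ends_at G v \<longleftrightarrow> e \<in> arcs G \<and> (case d of Source \<Rightarrow> tail G e | Target \<Rightarrow> head G e) = v"
  by (cases d) (auto simp: ends_at_def)

lemma finite_ends_at: "finite (arcs G) \<Longrightarrow> finite (ends_at G v)"
  by (rule finite_subset[of _ "arcs G \<times> {Source, Target}"]) (auto simp: ends_at_def)

lemma (in wf_digraph) C10_cases:
  assumes "X \<in> carrier (C10 G)"
  obtains y where "X = chain_class G y"
proof -
  have "X v \<in> F1_class G v ` (ends_at G v \<rightarrow>\<^sub>E UNIV)" if "v \<in> verts G" for v
    using assms that by (auto simp: C10_def PiE_iff simp flip: carrier_F1)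
  then have "\<forall>v\<in>verts G. \<exists>x. x \<in> ends_at G v \<rightarrow>\<^sub>E UNIV \<and> X v = F1_class G v x"
    by blast
  then obtain x where x: "\<And>v. v \<in> verts G \<Longrightarrow> x v \<in> ends_at G v \<rightarrow>\<^sub>E UNIV"
    "\<And>v. v \<in> verts G \<Longrightarrow> X v = F1_class G v (x v)"
    by metis
  define y where "y = (\<lambda>(e, d). x (case d of Source \<Rightarrow> tail G e | Target \<Rightarrow> head G e) (e, d))"
  have "X = chain_class G y"
  proof (rule extensionalityI[of _ "verts G"])
    fix v assume v: "v \<in> verts G"
    have "restrict y (ends_at G v) = x v"
      using x(1)[OF v] by (intro extensionalityI[of _ "ends_at G v"])
        (auto simp: y_def ends_at_iff PiE_def)
    then show "X v = chain_class G y v"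
      using v by (simp add: x(2) chain_class_def)
  qed (use assms in \<open>auto simp: C10_def chain_class_def PiE_def\<close>)
  then show thesis ..
qed

lemma bd1_eq: "bd1 G u = chain_class G (\<lambda>h. side_sgn (snd h) * u (fst h))"
  by (simp add: bd1_def chain_class_def)

lemma monodromy_eq:
  "monodromy G len \<gamma> = chain_class G
    (\<lambda>h. real_of_int (Poly_Mapping.lookup \<gamma> (fst h)) * (side_sgn (snd h) * to_midpoint len h))"
  by (simp add: monodromy_def chain_class_def)

lemma subgroup_bd1_image: "subgroup (bd1 G ` carrier (C11 G)) (C10 G)"
proof -
  interpret comm_group "C10 G"
    by (rule comm_group_C10)
  interpret group_hom "C11 G" "C10 G" "bd1 G"
  proof (intro group_hom.intro group_hom_axioms.intro homI)
    show "group (C11 G)"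
      by (simp add: C11_def group_real_group)
    show "bd1 G (x \<otimes>\<^bsub>C11 G\<^esub> y) = bd1 G x \<otimes>\<^bsub>C10 G\<^esub> bd1 G y"
      if "x \<in> carrier (C11 G)" "y \<in> carrier (C11 G)" for x y
      unfolding bd1_eq chain_class_mult unfolding chain_class_def
      by (intro restrict_ext arg_cong[of _ _ "F1_class G _"])
         (auto simp: C11_def ends_at_def algebra_simps intro!: restrict_ext)
  qed (simp_all add: is_group bd1_eq)
  show ?thesis
    by (rule img_is_subgroup)
qed

text \<open>
  The balancing lines at the vertices combine to a potential \<open>f\<close>, which enters with the
  sign of the end.
\<close>

lemma (in wf_digraph) chain_class_eq_iff:
  "chain_class G y = chain_class G y' \<longleftrightarrow>
    (\<exists>f. \<forall>e\<in>arcs G. y (e, Source) = f (tail G e) + y' (e, Source) \<and>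
                          y (e, Target) = - f (head G e) + y' (e, Target))"
proof -
  have all_ends: "(\<forall>v\<in>verts G. \<forall>h\<in>ends_at G v. P v h) \<longleftrightarrow>
      (\<forall>e\<in>arcs G. P (tail G e) (e, Source) \<and> P (head G e) (e, Target))" for P
    unfolding ends_at_def by (auto simp: Ball_def; metis tail_in_verts head_in_verts)
  have "chain_class G y = chain_class G y' \<longleftrightarrow>
      (\<forall>v\<in>verts G. \<exists>r. \<forall>h\<in>ends_at G v. y h = r * side_sgn (snd h) + y' h)"
    unfolding chain_class_def by (auto simp: fun_eq_iff restrict_def F1_class_eq_iff) 
  also have "\<dots> \<longleftrightarrow> (\<exists>f. \<forall>v\<in>verts G. \<forall>h\<in>ends_at G v. y h = f v * side_sgn (snd h) + y' h)"
    by metis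
  also have "\<dots> \<longleftrightarrow> (\<exists>f. \<forall>e\<in>arcs G. y (e, Source) = f (tail G e) + y' (e, Source) \<and>
                          y (e, Target) = - f (head G e) + y' (e, Target))"
    by (simp add: all_ends)
  finally show ?thesis .
qed

text \<open>
  At both ends the sign of the end cancels against the direction of the vector to the midpoint, and
  the two half-lengths add up to the length.
\<close>

lemma end_sum_monodromy:
  "end_sum (\<lambda>h. real_of_int (Poly_Mapping.lookup \<gamma> (fst h)) * (side_sgn (snd h) * to_midpoint len h)) =
    period_vector len \<gamma>"
  by (simp add: end_sum_def to_midpoint_def fun_eq_iff)

lemma end_sum_add: "end_sum (\<lambda>h. x h + y h) = (\<lambda>e. end_sum x e + end_sum y e)"
  by (simp add: end_sum_def fun_eq_iff)

context chain_connected
begin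

text \<open>
  This is the isomorphism of \<open>H\<^sub>1\<^sub>,\<^sub>0\<close> with the dual of
  \<open>\<Omega>\<close>: boundaries leave the end sums unchanged, balancing lines change them by
  gradients, and conversely a gradient difference of end sums is produced by these two.
\<close>

lemma H10_class_eq_iff:
  "H10_class G (chain_class G y) = H10_class G (chain_class G y') \<longleftrightarrow>
    functional G (end_sum y) = functional G (end_sum y')"
proof -
  have "H10_class G (chain_class G y) = H10_class G (chain_class G y') \<longleftrightarrow>
      (\<exists>u\<in>carrier (C11 G). chain_class G y = chain_class G (\<lambda>h. side_sgn (snd h) * u (fst h) + y' h))"
    unfolding H10_class_def
    by (subst comm_group.r_coset_eq_iff[OF comm_group_C10 subgroup_bd1_image])
       (auto simp: bd1_eq chain_class_mult)
  also have "\<dots> \<longleftrightarrow> (\<exists>u\<in>carrier (C11 G). \<exists>f. \<forall>e\<in>arcs G.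
      y (e, Source) = f (tail G e) + (u e + y' (e, Source)) \<and>
      y (e, Target) = - f (head G e) + (- u e + y' (e, Target)))"
    by (simp add: chain_class_eq_iff)
  also have "\<dots> \<longleftrightarrow> (\<exists>f. \<forall>e\<in>arcs G. end_sum y e - end_sum y' e = f (tail G e) - f (head G e))"
  proof
    assume "\<exists>f. \<forall>e\<in>arcs G. end_sum y e - end_sum y' e = f (tail G e) - f (head G e)"
    then obtain f where f: "\<forall>e\<in>arcs G. end_sum y e - end_sum y' e = f (tail G e) - f (head G e)"
      by blast
    \<comment> \<open>the potential \<open>f\<close> is absorbed by the balancing lines; the boundary of \<open>u\<close> corrects
      the source ends, and then the target ends agree as well\<close>
    define u where "u = (\<lambda>e\<in>arcs G. y (e, Source) - y' (e, Source) - f (tail G e))"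
    have "u \<in> carrier (C11 G)"
      by (simp add: C11_def u_def)
    moreover have "\<forall>e\<in>arcs G. y (e, Source) = f (tail G e) + (u e + y' (e, Source)) \<and>
      y (e, Target) = - f (head G e) + (- u e + y' (e, Target))"
      using f by (auto simp: u_def end_sum_def algebra_simps)
    ultimately show "\<exists>u\<in>carrier (C11 G). \<exists>f. \<forall>e\<in>arcs G.
      y (e, Source) = f (tail G e) + (u e + y' (e, Source)) \<and>
      y (e, Target) = - f (head G e) + (- u e + y' (e, Target))"
      by blast
  next
    assume "\<exists>u\<in>carrier (C11 G). \<exists>f. \<forall>e\<in>arcs G.
      y (e, Source) = f (tail G e) + (u e + y' (e, Source)) \<and>
      y (e, Target) = - f (head G e) + (- u e + y' (e, Target))"
    then show "\<exists>f. \<forall>e\<in>arcs G. end_sum y e - end_sum y' e = f (tail G e) - f (head G e)"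
      by (elim bexE exE) (force simp: end_sum_def)
  qed
  also have "\<dots> \<longleftrightarrow> functional G (end_sum y) = functional G (end_sum y')"
    by (simp add: functional_eq_iff)
  finally show ?thesis .
qed

lemma comm_group_H10: "comm_group (H10 G)"
  unfolding H10_def by (rule comm_group.abelian_FactGroup[OF comm_group_C10 subgroup_bd1_image])

lemma H10_class_hom: "H10_class G \<in> hom (C10 G) (H10 G)"
  unfolding H10_def H10_class_def[abs_def]
  by (rule normal.r_coset_hom_Mod)
     (rule comm_group.subgroup_imp_normal[OF comm_group_C10 subgroup_bd1_image])

lemma carrier_H10: "carrier (H10 G) = H10_class G ` carrier (C10 G)"
  by (simp add: H10_def H10_class_def[abs_def] carrier_FactGroup)

lemma H10_class_mult:
  "H10_class G (chain_class G x) \<otimes>\<^bsub>H10 G\<^esub> H10_class G (chain_class G y) =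
    H10_class G (chain_class G (\<lambda>h. x h + y h))"
  using hom_mult[OF H10_class_hom chain_class_closed chain_class_closed, of x y]
  by (simp add: chain_class_mult)

lemma H10_class_chain_class_closed [simp]: "H10_class G (chain_class G y) \<in> carrier (H10 G)"
  by (simp add: carrier_H10)

lemma subgroup_monodromy_lattice: "subgroup (monodromy_lattice G len) (H10 G)"
proof -
  interpret H: comm_group "H10 G"
    by (rule comm_group_H10)
  interpret group_hom "C01 G" "H10 G" "\<lambda>\<gamma>. H10_class G (monodromy G len \<gamma>)"
    by (intro group_hom.intro group_hom_axioms.intro homI)
       (simp_all add: C01_def H.is_group monodromy_eq H10_class_mult lookup_add distrib_right)
  show ?thesis
    unfolding monodromy_lattice_def by (rule subgroup_img_is_subgroup[OF subgroup_H01])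
qed

lemma carrier_JH10: "carrier (JH10 G len) = JH10_class G len ` carrier (C10 G)"
  by (simp add: JH10_def JH10_class_def[abs_def] carrier_FactGroup carrier_H10 image_image)

lemma JH10_class_hom: "JH10_class G len \<in> hom (C10 G) (JH10 G len)"
proof -
  have "(\<lambda>c. monodromy_lattice G len #>\<^bsub>H10 G\<^esub> c) \<in> hom (H10 G) (JH10 G len)"
    unfolding JH10_def
    by (rule normal.r_coset_hom_Mod)
       (rule comm_group.subgroup_imp_normal[OF comm_group_H10 subgroup_monodromy_lattice])
  from hom_compose[OF H10_class_hom this] show ?thesis
    by (simp add: JH10_class_def[abs_def] o_def)
qed

text \<open>
  The monodromy lattice and the period lattice have the same coordinates in
  \<open>\<real>\<^sup>E\<close>.
\<close>

lemma JH10_class_eq_iff: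
  "JH10_class G len (chain_class G y) = JH10_class G len (chain_class G y') \<longleftrightarrow>
    Jac_class G len (functional G (end_sum y)) = Jac_class G len (functional G (end_sum y'))"
  unfolding JH10_class_def Jac_class_eq_iff
  by (subst comm_group.r_coset_eq_iff[OF comm_group_H10 subgroup_monodromy_lattice])
     (simp_all add: monodromy_lattice_def monodromy_eq H10_class_mult H10_class_eq_iff end_sum_add end_sum_monodromy)

end

section \<open>The isomorphism\<close>

text \<open>
  A chain with end sum \<open>-c\<close>. The sign accounts for the two opposite conventions for the
  boundary of an edge.
\<close>

definition source_chain :: "('e \<Rightarrow> real) \<Rightarrow> 'e \<times> side \<Rightarrow> real" where
  "source_chain c h = (case snd h of Source \<Rightarrow> - c (fst h) | Target \<Rightarrow> 0)"

lemma end_sum_source_chain: "end_sum (source_chain c) = (\<lambda>e. - c e)"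
  by (simp add: end_sum_def source_chain_def fun_eq_iff)

lemma functional_uminus_eq_iff:
  "functional G (\<lambda>e. - c e) = functional G (\<lambda>e. - d e) \<longleftrightarrow> functional G c = functional G d"
  by (simp add: functional_eq_on_Omega sum_negf)

lemma (in fin_digraph) sum_ends_at:
  "(\<Sum>h\<in>ends_at G v. f h) =
    (\<Sum>e | e \<in> arcs G \<and> tail G e = v. f (e, Source)) + (\<Sum>e | e \<in> arcs G \<and> head G e = v. f (e, Target))"
proof -
  have "ends_at G v = (\<lambda>e. (e, Source)) ` {e \<in> arcs G. tail G e = v} \<union> (\<lambda>e. (e, Target)) ` {e \<in> arcs G. head G e = v}"
    by (auto simp: ends_at_def)
  moreover have "(\<lambda>e. (e, Source)) ` {e \<in> arcs G. tail G e = v} \<inter> (\<lambda>e. (e, Target)) ` {e \<in> arcs G. head G e = v} = {}"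
    by auto
  ultimately show ?thesis
    by (simp add: sum.union_disjoint sum.reindex inj_on_def)
qed

lemma (in fin_digraph) sum_all_ends:
  "(\<Sum>v\<in>verts G. \<Sum>h\<in>ends_at G v. f h) = (\<Sum>e\<in>arcs G. f (e, Source) + f (e, Target))"
proof -
  have "(\<Sum>v\<in>verts G. \<Sum>e | e \<in> arcs G \<and> w e = v. f (e, s)) = (\<Sum>e\<in>arcs G. f (e, s))"
    if "w ` arcs G \<subseteq> verts G" for w s
    by (rule sum.group[OF finite_arcs finite_verts that])
  moreover have "tail G ` arcs G \<subseteq> verts G" "head G ` arcs G \<subseteq> verts G"
    by auto
  ultimately show ?thesis
    by (simp add: sum_ends_at sum.distrib)
qed

text \<open>
  Harmonicity at \<open>v\<close> says that the form annihilates the balancing line, so the value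
  does not depend on the chosen representative.
\<close>

definition end_pairing ::
  "('v,'e) pre_digraph \<Rightarrow> ('e \<Rightarrow> real) \<Rightarrow> 'v \<Rightarrow> ('e \<times> side \<Rightarrow> real) set \<Rightarrow> real" where
  "end_pairing G \<omega> v k = (\<Sum>h\<in>ends_at G v. (SOME x. x \<in> k) h * \<omega> (fst h))"

text \<open>
  The inverse of the isomorphism on the level of chains, with the same sign as in
  \<open>source_chain\<close>.
\<close>

definition chain_functional ::
  "('v,'e) pre_digraph \<Rightarrow> ('v \<Rightarrow> ('e \<times> side \<Rightarrow> real) set) \<Rightarrow> ('e \<Rightarrow> real) \<Rightarrow> real" where
  "chain_functional G X = (\<lambda>\<omega>\<in>Omega G. - (\<Sum>v\<in>verts G. end_pairing G \<omega> v (X v)))"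

context chain_connected
begin

lemma Jac_class_uminus_eq_iff:
  "Jac_class G len (functional G (\<lambda>e. - c e)) = Jac_class G len (functional G (\<lambda>e. - d e)) \<longleftrightarrow>
    Jac_class G len (functional G c) = Jac_class G len (functional G d)"
proof -
  have "\<exists>\<gamma>\<in>H01 G. functional G (\<lambda>e. - c e) = functional G (\<lambda>e. period_vector len \<gamma> e + (- d e))"
    if "\<exists>\<gamma>\<in>H01 G. functional G c = functional G (\<lambda>e. period_vector len \<gamma> e + d e)" for c d
  proof -
    from that obtain \<gamma> where \<gamma>: "\<gamma> \<in> H01 G"
      and eq: "functional G c = functional G (\<lambda>e. period_vector len \<gamma> e + d e)"
      by blast
    from \<gamma> have "- \<gamma> \<in> H01 G"
      by (simp add: H01_iff carrier_C01_iff harmonic_def sum_negf)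
    moreover have "functional G (\<lambda>e. - c e) = functional G (\<lambda>e. period_vector len (- \<gamma>) e + (- d e))"
      using eq functional_uminus_eq_iff[of G c "\<lambda>e. period_vector len \<gamma> e + d e"] by simp
    ultimately show ?thesis ..
  qed
  from this[of c d] this[of "\<lambda>e. - c e" "\<lambda>e. - d e"] show ?thesis
    unfolding Jac_class_eq_iff by auto
qed

text \<open>
  The coordinates \<open>F(z\<^sub>e)\<close> make this lift of a linear form to a chain continuous.
\<close>

definition dual_to_chain :: "(('e \<Rightarrow> real) \<Rightarrow> real) \<Rightarrow> 'v \<Rightarrow> ('e \<times> side \<Rightarrow> real) set" where
  "dual_to_chain F = chain_class G (source_chain (\<lambda>e. F (fundamental_form e)))"

lemma dual_to_chain_closed: "dual_to_chain F \<in> carrier (C10 G)"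
  by (simp add: dual_to_chain_def)

lemma JH10_class_dual_to_chain:
  "JH10_class G len (dual_to_chain (functional G c)) = JH10_class G len (chain_class G (source_chain c))"
  using Omega_dual_eq_functional[OF functional_closed, of c]
  by (simp add: dual_to_chain_def JH10_class_eq_iff end_sum_source_chain Jac_class_uminus_eq_iff)

text \<open>
  Both well-definedness and injectivity of the induced map on the Jacobian.
\<close>

lemma JH10_class_dual_to_chain_eq_iff:
  assumes "F \<in> carrier (Omega_dual G)" "F' \<in> carrier (Omega_dual G)"
  shows "JH10_class G len (dual_to_chain F) = JH10_class G len (dual_to_chain F') \<longleftrightarrow>
    Jac_class G len F = Jac_class G len F'"
  using assms
  by (elim Omega_dual_cases)
     (simp add: JH10_class_dual_to_chain JH10_class_eq_iff end_sum_source_chain Jac_class_uminus_eq_iff)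

lemma JH10_class_chain_class:
  "JH10_class G len (chain_class G y) = JH10_class G len (dual_to_chain (functional G (\<lambda>e. - end_sum y e)))"
  by (simp add: JH10_class_dual_to_chain JH10_class_eq_iff end_sum_source_chain)

lemma JH10_class_dual_to_chain_mult:
  assumes "F \<in> carrier (Omega_dual G)" "F' \<in> carrier (Omega_dual G)"
  shows "JH10_class G len (dual_to_chain (F \<otimes>\<^bsub>Omega_dual G\<^esub> F')) =
    JH10_class G len (dual_to_chain F) \<otimes>\<^bsub>JH10 G len\<^esub> JH10_class G len (dual_to_chain F')"
proof -
  obtain c c' where c: "F = functional G c" "F' = functional G c'"
    using assms by (metis Omega_dual_cases)
  have "(\<lambda>h. source_chain c h + source_chain c' h) = source_chain (\<lambda>e. c e + c' e)"
    by (auto simp: source_chain_def fun_eq_iff split: side.split)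
  then have "chain_class G (source_chain c) \<otimes>\<^bsub>C10 G\<^esub> chain_class G (source_chain c') =
      chain_class G (source_chain (\<lambda>e. c e + c' e))"
    by (simp add: chain_class_mult)
  then show ?thesis
    using hom_mult[OF JH10_class_hom chain_class_closed chain_class_closed, of len "source_chain c" "source_chain c'"]
    by (simp add: c functional_mult JH10_class_dual_to_chain)
qed

definition Jac_to_JH10 ::
  "('e \<Rightarrow> real) \<Rightarrow> (('e \<Rightarrow> real) \<Rightarrow> real) set \<Rightarrow> ('v \<Rightarrow> ('e \<times> side \<Rightarrow> real) set) set set" where
  "Jac_to_JH10 len = (\<lambda>c\<in>carrier (Jac G len).
     JH10_class G len (dual_to_chain (inv_into (carrier (Omega_dual G)) (Jac_class G len) c)))"

lemma Jac_to_JH10_Jac_class: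
  assumes "F \<in> carrier (Omega_dual G)"
  shows "Jac_to_JH10 len (Jac_class G len F) = JH10_class G len (dual_to_chain F)"
proof -
  let ?c = "Jac_class G len F"
  have c: "?c \<in> Jac_class G len ` carrier (Omega_dual G)"
    using assms by simp
  show ?thesis
    using JH10_class_dual_to_chain_eq_iff[OF inv_into_into[OF c] assms] f_inv_into_f[OF c] c
    by (simp add: Jac_to_JH10_def carrier_Jac)
qed

lemma Jac_to_JH10_iso: "Jac_to_JH10 len \<in> iso (Jac G len) (JH10 G len)"
proof (rule isoI)
  interpret N: normal "period_lattice G len" "Omega_dual G"
    by (rule comm_group.subgroup_imp_normal[OF comm_group_Omega_dual subgroup_period_lattice])
  show "Jac_to_JH10 len \<in> hom (Jac G len) (JH10 G len)"
  proof (rule homI)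
    fix x assume "x \<in> carrier (Jac G len)"
    then show "Jac_to_JH10 len x \<in> carrier (JH10 G len)"
      by (auto simp: carrier_Jac Jac_to_JH10_Jac_class carrier_JH10 dual_to_chain_closed)
  next
    fix x y assume "x \<in> carrier (Jac G len)" "y \<in> carrier (Jac G len)"
    then obtain F F' where F: "F \<in> carrier (Omega_dual G)" "F' \<in> carrier (Omega_dual G)"
      and xy: "x = Jac_class G len F" "y = Jac_class G len F'"
      by (auto simp: carrier_Jac)
    have "x \<otimes>\<^bsub>Jac G len\<^esub> y = Jac_class G len (F \<otimes>\<^bsub>Omega_dual G\<^esub> F')"
      using N.rcos_sum[OF F] by (simp add: xy Jac_def Jac_class_def)
    then show "Jac_to_JH10 len (x \<otimes>\<^bsub>Jac G len\<^esub> y) =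
        Jac_to_JH10 len x \<otimes>\<^bsub>JH10 G len\<^esub> Jac_to_JH10 len y"
      using F by (simp add: xy Jac_to_JH10_Jac_class JH10_class_dual_to_chain_mult)
  qed
  show "bij_betw (Jac_to_JH10 len) (carrier (Jac G len)) (carrier (JH10 G len))"
  proof (rule bij_betw_imageI)
    show "inj_on (Jac_to_JH10 len) (carrier (Jac G len))"
      by (auto simp: inj_on_def carrier_Jac Jac_to_JH10_Jac_class JH10_class_dual_to_chain_eq_iff)
    have "Jac_to_JH10 len ` carrier (Jac G len) = (\<lambda>F. JH10_class G len (dual_to_chain F)) ` carrier (Omega_dual G)"
      by (simp add: carrier_Jac image_image Jac_to_JH10_Jac_class cong: image_cong)
    also have "\<dots> = JH10_class G len ` carrier (C10 G)"
    proof (intro subset_antisym image_subsetI)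
      fix X assume "X \<in> carrier (C10 G)"
      then obtain y where "X = chain_class G y"
        by (rule C10_cases)
      then show "JH10_class G len X \<in> (\<lambda>F. JH10_class G len (dual_to_chain F)) ` carrier (Omega_dual G)"
        using JH10_class_chain_class[of len y] by (auto intro!: image_eqI)
    qed (simp add: dual_to_chain_closed)
    also have "\<dots> = carrier (JH10 G len)"
      by (simp add: carrier_JH10)
    finally show "Jac_to_JH10 len ` carrier (Jac G len) = carrier (JH10 G len)" .
  qed
qed

section \<open>The isomorphism is a homeomorphism\<close>

lemma topspace_Omega_dual: "topspace (Omega_dual_topology G) = carrier (Omega_dual G)"
  by (auto simp: Omega_dual_topology_def carrier_Omega_dual Omega_dual_carrier_def)

lemma topspace_F1: "topspace (F1_topology G v) = carrier (F1 G v)"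
  by (simp add: F1_topology_def topspace_quot_topology carrier_F1)

lemma topspace_C10: "topspace (product_topology (F1_topology G) (verts G)) = carrier (C10 G)"
  by (simp add: topspace_F1 C10_def)

lemma quotient_map_Jac_class: "quotient_map (Omega_dual_topology G) (Jac_topology G len) (Jac_class G len)"
  unfolding Jac_topology_def by (rule quotient_map_quot_topology)

lemma quotient_map_JH10_class:
  "quotient_map (product_topology (F1_topology G) (verts G)) (JH10_topology G len) (JH10_class G len)"
  using quotient_map_compose[OF quotient_map_quot_topology quotient_map_quot_topology]
  by (simp add: JH10_topology_def JH10_class_def[abs_def] o_def)

lemma quotient_map_F1_class:
  "quotient_map (product_topology (\<lambda>_. euclideanreal) (ends_at G v)) (F1_topology G v) (F1_class G v)"
  unfolding F1_topology_def by (rule quotient_map_quot_topology)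

lemma topspace_Jac: "topspace (Jac_topology G len) = carrier (Jac G len)"
  using quotient_imp_surjective_map[OF quotient_map_Jac_class, of len]
  by (simp add: topspace_Omega_dual carrier_Jac)

lemma topspace_JH10: "topspace (JH10_topology G len) = carrier (JH10 G len)"
  using quotient_imp_surjective_map[OF quotient_map_JH10_class, of len]
  by (simp only: topspace_C10 carrier_JH10)

lemma continuous_map_dual_to_chain:
  "continuous_map (Omega_dual_topology G) (product_topology (F1_topology G) (verts G)) dual_to_chain"
proof -
  have "continuous_map (Omega_dual_topology G) (F1_topology G v) (\<lambda>F. dual_to_chain F v)"
    if v: "v \<in> verts G" for v
  proof -
    have proj: "continuous_map (Omega_dual_topology G) euclideanreal (\<lambda>F. F (fundamental_form e))"
      if "e \<in> arcs G" for e
      unfolding Omega_dual_topology_def using fundamental_form_in_Omega[OF that]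
      by (intro continuous_map_from_subtopology continuous_map_product_projection)
    have "continuous_map (Omega_dual_topology G) euclideanreal
        (\<lambda>F. source_chain (\<lambda>e. F (fundamental_form e)) h)" if "h \<in> ends_at G v" for h
      using that proj by (cases "snd h") (auto simp: source_chain_def ends_at_def intro!: continuous_intros)
    then have "continuous_map (Omega_dual_topology G) (product_topology (\<lambda>_. euclideanreal) (ends_at G v))
        (\<lambda>F. \<lambda>h\<in>ends_at G v. source_chain (\<lambda>e. F (fundamental_form e)) h)"
      by (auto simp: continuous_map_componentwise)
    from continuous_map_compose[OF this quotient_imp_continuous_map[OF quotient_map_F1_class]]
    show ?thesis
      using v by (simp add: o_def dual_to_chain_def chain_class_def)
  qed
  moreover have "dual_to_chain F \<in> extensional (verts G)" for F
    by (simp add: dual_to_chain_def chain_class_def)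
  ultimately show ?thesis
    by (auto simp: continuous_map_componentwise)
qed

lemma continuous_map_Jac_to_JH10:
  "continuous_map (Jac_topology G len) (JH10_topology G len) (Jac_to_JH10 len)"
proof (rule continuous_compose_quotient_map[OF quotient_map_Jac_class])
  have "continuous_map (Omega_dual_topology G) (JH10_topology G len) (JH10_class G len \<circ> dual_to_chain)"
    by (rule continuous_map_compose[OF continuous_map_dual_to_chain
          quotient_imp_continuous_map[OF quotient_map_JH10_class]])
  then show "continuous_map (Omega_dual_topology G) (JH10_topology G len) (Jac_to_JH10 len \<circ> Jac_class G len)"
    by (rule continuous_map_eq) (simp add: topspace_Omega_dual Jac_to_JH10_Jac_class)
qed

lemma end_pairing_F1_class:
  assumes "harmonic G \<omega>" "v \<in> verts G"
  shows "end_pairing G \<omega> v (F1_class G v x) = (\<Sum>h\<in>ends_at G v. x h * \<omega> (fst h))"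
proof -
  have "(SOME x'. x' \<in> F1_class G v x) \<in> F1_class G v x"
    unfolding F1_class_eq some_in_eq by simp
  then obtain r where r: "(SOME x'. x' \<in> F1_class G v x) = (\<lambda>h\<in>ends_at G v. r * side_sgn (snd h) + x h)"
    by (auto simp: F1_class_eq)
  have "end_pairing G \<omega> v (F1_class G v x) =
      (\<Sum>h\<in>ends_at G v. r * (side_sgn (snd h) * \<omega> (fst h)) + x h * \<omega> (fst h))"
    unfolding end_pairing_def r by (intro sum.cong refl) (simp add: algebra_simps)
  also have "\<dots> = r * (\<Sum>h\<in>ends_at G v. side_sgn (snd h) * \<omega> (fst h)) + (\<Sum>h\<in>ends_at G v. x h * \<omega> (fst h))"
    by (simp add: sum.distrib sum_distrib_left)
  also have "(\<Sum>h\<in>ends_at G v. side_sgn (snd h) * \<omega> (fst h)) = 0"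
    using assms by (simp add: sum_ends_at harmonic_def sum_negf)
  finally show ?thesis
    by simp
qed

lemma chain_functional_chain_class:
  "chain_functional G (chain_class G y) = functional G (\<lambda>e. - end_sum y e)"
proof -
  have "(\<Sum>v\<in>verts G. end_pairing G \<omega> v (chain_class G y v)) = (\<Sum>e\<in>arcs G. end_sum y e * \<omega> e)"
    if "\<omega> \<in> Omega G" for \<omega>
  proof -
    have "(\<Sum>v\<in>verts G. end_pairing G \<omega> v (chain_class G y v)) =
        (\<Sum>v\<in>verts G. \<Sum>h\<in>ends_at G v. y h * \<omega> (fst h))"
      using that by (intro sum.cong refl) (simp add: chain_class_def end_pairing_F1_class Omega_iff)
    then show ?thesis
      by (simp add: sum_all_ends end_sum_def distrib_right)
  qed
  then show ?thesis
    by (auto simp: chain_functional_def functional_def sum_negf intro!: restrict_ext)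
qed

text \<open>
  A chain space is a product of quotients of products of real lines; on each factor the pairing with
  a fixed form lifts to a finite linear sum, which is continuous.
\<close>

lemma continuous_map_chain_functional:
  "continuous_map (product_topology (F1_topology G) (verts G)) (Omega_dual_topology G) (chain_functional G)"
proof -
  have pairing: "continuous_map (F1_topology G v) euclideanreal (end_pairing G \<omega> v)"
    if "\<omega> \<in> Omega G" "v \<in> verts G" for \<omega> v
  proof (rule continuous_compose_quotient_map[OF quotient_map_F1_class])
    have "continuous_map (product_topology (\<lambda>_. euclideanreal) (ends_at G v)) euclideanreal
        (\<lambda>x. \<Sum>h\<in>ends_at G v. x h * \<omega> (fst h))"
      by (intro continuous_intros finite_ends_at finite_arcs)
         (auto intro!: continuous_map_real_mult_right continuous_map_product_projection)
    then show "continuous_map (product_topology (\<lambda>_. euclideanreal) (ends_at G v)) euclideanreal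
        (end_pairing G \<omega> v \<circ> F1_class G v)"
      using that by (simp add: o_def end_pairing_F1_class Omega_iff)
  qed
  have "continuous_map (product_topology (F1_topology G) (verts G)) euclideanreal
      (\<lambda>X. chain_functional G X \<omega>)" if "\<omega> \<in> Omega G" for \<omega>
  proof -
    have "continuous_map (product_topology (F1_topology G) (verts G)) euclideanreal
        (\<lambda>X. end_pairing G \<omega> v (X v))" if "v \<in> verts G" for v
      using continuous_map_compose[OF continuous_map_product_projection[OF that, of "F1_topology G"] pairing[OF \<open>\<omega> \<in> Omega G\<close> that]]
      by (simp add: o_def)
    then show ?thesis
      using that by (simp add: chain_functional_def continuous_map_minus continuous_map_sum)
  qed
  then have "continuous_map (product_topology (F1_topology G) (verts G))
      (product_topology (\<lambda>_. euclideanreal) (Omega G)) (chain_functional G)"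
    by (auto simp: continuous_map_componentwise chain_functional_def)
  moreover have "chain_functional G X \<in> Omega_dual_carrier G" if X: "X \<in> carrier (C10 G)" for X
    using X by (rule C10_cases) (simp add: chain_functional_chain_class functional_closed)
  ultimately show ?thesis
    unfolding Omega_dual_topology_def
    by (intro continuous_map_into_subtopology) (simp_all only: topspace_C10 Pi_iff, blast)
qed

text \<open>
  The inverse is induced by \<open>chain_functional\<close>; since the projection from the chains is
  a quotient map, continuity can be checked there.
\<close>

lemma homeomorphic_map_Jac_to_JH10:
  "homeomorphic_map (Jac_topology G len) (JH10_topology G len) (Jac_to_JH10 len)"
proof -
  let ?\<psi> = "inv_into (carrier (Jac G len)) (Jac_to_JH10 len)"
  have bij: "bij_betw (Jac_to_JH10 len) (carrier (Jac G len)) (carrier (JH10 G len))"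
    using Jac_to_JH10_iso by (simp add: iso_def)
  have "continuous_map (JH10_topology G len) (Jac_topology G len) ?\<psi>"
  proof (rule continuous_compose_quotient_map[OF quotient_map_JH10_class])
    have "continuous_map (product_topology (F1_topology G) (verts G)) (Jac_topology G len)
        (Jac_class G len \<circ> chain_functional G)"
      by (rule continuous_map_compose[OF continuous_map_chain_functional
            quotient_imp_continuous_map[OF quotient_map_Jac_class]])
    then show "continuous_map (product_topology (F1_topology G) (verts G)) (Jac_topology G len)
        (?\<psi> \<circ> JH10_class G len)"
    proof (rule continuous_map_eq)
      fix X assume "X \<in> topspace (product_topology (F1_topology G) (verts G))"
      then have "X \<in> carrier (C10 G)"
        by (simp only: topspace_C10)
      then obtain y where y: "X = chain_class G y"
        by (rule C10_cases)
      have "Jac_class G len (chain_functional G X) \<in> carrier (Jac G len)"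
        by (simp add: y chain_functional_chain_class carrier_Jac)
      moreover have "Jac_to_JH10 len (Jac_class G len (chain_functional G X)) = JH10_class G len X"
        by (simp add: y chain_functional_chain_class Jac_to_JH10_Jac_class JH10_class_chain_class[of len y])
      ultimately show "(Jac_class G len \<circ> chain_functional G) X = (?\<psi> \<circ> JH10_class G len) X"
        using inv_into_f_f[OF bij_betw_imp_inj_on[OF bij]] by (metis comp_apply)
    qed
  qed
  then have "homeomorphic_maps (Jac_topology G len) (JH10_topology G len) (Jac_to_JH10 len) ?\<psi>"
    unfolding homeomorphic_maps_def topspace_Jac topspace_JH10
    using continuous_map_Jac_to_JH10 bij_betw_inv_into_left[OF bij] bij_betw_inv_into_right[OF bij]
    by blast
  then show ?thesis
    unfolding homeomorphic_map_maps by blast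
qed

end

section \<open>Subdivided segments\<close>

definition consecutive :: "real set \<Rightarrow> (real \<times> real) set" where
  "consecutive P = {(a, b). a \<in> P \<and> b \<in> P \<and> a < b \<and> (\<forall>c\<in>P. \<not> (a < c \<and> c < b))}"

lemma finite_consecutive: "finite P \<Longrightarrow> finite (consecutive P)"
  by (rule finite_subset[of _ "P \<times> P"]) (auto simp: consecutive_def)

text \<open>
  Induction on the largest point: unless it is the only one, it adds exactly one pair, formed with
  the previous largest point.
\<close>

lemma sum_consecutive_telescope:
  fixes g :: "real \<Rightarrow> 'a::ab_group_add"
  assumes "finite P" "l \<in> P" "\<And>x. x \<in> P \<Longrightarrow> l \<le> x" "u \<in> P" "\<And>x. x \<in> P \<Longrightarrow> x \<le> u"
  shows "(\<Sum>(a, b)\<in>consecutive P. g b - g a) = g u - g l"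
  using assms
proof (induction P arbitrary: u rule: finite_linorder_max_induct)
  case empty
  then show ?case
    by simp
next
  case (insert m A)
  have um: "u = m"
    using insert.prems insert.hyps by (metis insertE insertI1 less_le_not_le)
  show ?case
  proof (cases "A = {}")
    case True
    then show ?thesis
      using insert.prems by (auto simp: consecutive_def intro!: sum.neutral)
  next
    case False
    obtain w where w: "w \<in> A" "\<And>x. x \<in> A \<Longrightarrow> x \<le> w"
      using Max_in[OF insert.hyps(1) False] Max_ge[OF insert.hyps(1)] by blast
    have l: "l \<in> A"
      using insert.prems(1) insert.prems(2)[of w] insert.hyps(2) w(1) by force
    have eq: "consecutive (insert m A) = insert (w, m) (consecutive A)"
    proof (intro subset_antisym subrelI)
      fix a b assume ab: "(a, b) \<in> consecutive (insert m A)"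
      then have "a \<in> insert m A" "b \<in> insert m A" and "a < b"
        by (auto simp: consecutive_def)
      then have a: "a \<in> A" "a < b"
        using insert.hyps(2) by force+
      show "(a, b) \<in> insert (w, m) (consecutive A)"
      proof (cases "b = m")
        case True
        have "\<not> a < w"
          using ab w(1) insert.hyps True by (auto simp: consecutive_def)
        then have "a = w"
          using w(2)[OF a(1)] by simp
        with True show ?thesis
          by simp
      qed (use ab a in \<open>auto simp: consecutive_def\<close>)
    next
      fix a b assume "(a, b) \<in> insert (w, m) (consecutive A)"
      then consider "a = w" "b = m" | "(a, b) \<in> consecutive A"
        by blast
      then show "(a, b) \<in> consecutive (insert m A)"
      proof cases
        case 1
        then show ?thesis
          using w insert.hyps(2) by (auto simp: consecutive_def not_less)
      next
        case 2
        then have "\<not> m < b"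
          using insert.hyps(2) by (force simp: consecutive_def)
        with 2 show ?thesis
          by (auto simp: consecutive_def)
      qed
    qed
    have "(w, m) \<notin> consecutive A"
      using insert.hyps by (auto simp: consecutive_def)
    then have "(\<Sum>(a, b)\<in>consecutive (insert m A). g b - g a) =
        (g m - g w) + (\<Sum>(a, b)\<in>consecutive A. g b - g a)"
      unfolding eq using finite_consecutive[OF insert.hyps(1)] by (subst sum.insert) auto
    also have "(\<Sum>(a, b)\<in>consecutive A. g b - g a) = g w - g l"
      using l w insert.prems(2) by (intro insert.IH) auto
    finally show ?thesis
      by (simp add: um)
  qed
qed

lemma exists_frag:
  fixes f :: "'a \<Rightarrow> int"
  assumes "finite A"
  shows "\<exists>\<gamma>. Poly_Mapping.keys \<gamma> \<subseteq> A \<and> (\<forall>e\<in>A. Poly_Mapping.lookup \<gamma> e = f e)"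
proof (intro exI conjI ballI)
  let ?\<gamma> = "\<Sum>x\<in>A. frag_cmul (f x) (frag_of x)"
  show "Poly_Mapping.keys ?\<gamma> \<subseteq> A"
    using keys_sum[of "\<lambda>x. frag_cmul (f x) (frag_of x)" A] by (auto split: if_splits)
  show "Poly_Mapping.lookup ?\<gamma> e = f e" if "e \<in> A" for e
    using that assms by (simp add: lookup_sum if_distrib[of "\<lambda>x. _ * x"] cong: if_cong)
qed

section \<open>Refinements of a model\<close>

locale refined_model = chain_connected G for G :: "('v,'e) pre_digraph" +
  fixes len :: "'e \<Rightarrow> real" and S :: "('v,'e) point set"
  assumes len_pos: "e \<in> arcs G \<Longrightarrow> 0 < len e"
    and finite_S: "finite S"
    and S_subset: "S \<subseteq> curve_points G len"
begin

abbreviation G' :: "(('v,'e) point, 'e \<times> real \<times> real) pre_digraph" where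
  "G' \<equiv> refine G len S"

abbreviation segments :: "'e \<Rightarrow> (real \<times> real) set" where
  "segments e \<equiv> consecutive (division_points len S e)"

lemma finite_division_points: "finite (division_points len S e)"
proof -
  have "finite ((\<lambda>t. Interior e t) -` S)"
    by (rule finite_vimageI[OF finite_S]) (auto simp: inj_def)
  then show ?thesis
    by (simp add: division_points_def vimage_def)
qed

lemma Interior_in_S: "Interior e t \<in> S \<Longrightarrow> e \<in> arcs G \<and> 0 < t \<and> t < len e"
  using S_subset by (auto simp: curve_points_def)

lemma division_points_bounds:
  assumes "e \<in> arcs G" "t \<in> division_points len S e"
  shows "0 \<le> t" "t \<le> len e"
  using assms len_pos[of e] Interior_in_S[of e t] by (auto simp: division_points_def)

lemma ends_in_division_points: "0 \<in> division_points len S e" "len e \<in> division_points len S e"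
  by (simp_all add: division_points_def)

lemma arcs_refine: "arcs G' = Sigma (arcs G) segments"
  by (auto simp: refine_def consecutive_def)

lemma in_arcs_refine: "(e, a, b) \<in> arcs G' \<longleftrightarrow> e \<in> arcs G \<and> (a, b) \<in> segments e"
  by (simp add: arcs_refine)

lemma tail_refine: "tail G' (e, a, b) = point_at G len e a"
  and head_refine: "head G' (e, a, b) = point_at G len e b"
  by (simp_all add: refine_def)

lemma verts_refine: "verts G' = Vertex ` verts G \<union> S"
proof -
  have "x \<in> Vertex ` verts G \<union> {Interior e t |e t. Interior e t \<in> S}" if "x \<in> S" for x
    using that S_subset by (cases x) (auto simp: curve_points_def)
  then show ?thesis
    by (auto simp: refine_def)
qed

lemma point_at_in_verts:
  assumes "e \<in> arcs G" "t \<in> division_points len S e"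
  shows "point_at G len e t \<in> verts G'"
  using assms by (auto simp: point_at_def verts_refine division_points_def)

lemma point_at_ends:
  assumes "e \<in> arcs G"
  shows "point_at G len e 0 = Vertex (tail G e)" "point_at G len e (len e) = Vertex (head G e)"
  using len_pos[OF assms] by (simp_all add: point_at_def)

lemma sum_arcs_refine:
  "(\<Sum>h\<in>arcs G'. f h) = (\<Sum>e\<in>arcs G. \<Sum>(a, b)\<in>segments e. f (e, a, b))"
proof -
  have "(\<Sum>e\<in>arcs G. \<Sum>s\<in>segments e. f (e, s)) = (\<Sum>h\<in>arcs G'. f h)"
    unfolding arcs_refine
    by (subst sum.Sigma) (simp_all add: finite_consecutive finite_division_points)
  then show ?thesis
    by (simp add: case_prod_unfold)
qed

lemma fin_digraph_refine: "fin_digraph G'"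
proof
  show "finite (arcs G')"
    unfolding arcs_refine by (intro finite_SigmaI finite_arcs finite_consecutive finite_division_points)
  show "finite (verts G')"
    by (simp add: verts_refine finite_S)
  fix h assume h: "h \<in> arcs G'"
  obtain e a b where "h = (e, a, b)"
    by (cases h)
  with h show "tail G' h \<in> verts G'" "head G' h \<in> verts G'"
    by (auto simp: in_arcs_refine consecutive_def tail_refine head_refine intro!: point_at_in_verts)
qed

lemma sum_segments_telescope:
  fixes g :: "real \<Rightarrow> 'a::ab_group_add"
  assumes "e \<in> arcs G"
  shows "(\<Sum>(a, b)\<in>segments e. g b - g a) = g (len e) - g 0"
  using finite_division_points ends_in_division_points division_points_bounds[OF assms]
  by (intro sum_consecutive_telescope)

lemma initial_segments: "{(a, b). (a, b) \<in> segments e \<and> b \<le> t} = consecutive (division_points len S e \<inter> {..t})"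
  by (fastforce simp: consecutive_def)

lemma sum_initial_segments_telescope:
  fixes g :: "real \<Rightarrow> 'a::ab_group_add"
  assumes "e \<in> arcs G" "t \<in> division_points len S e"
  shows "(\<Sum>(a, b) | (a, b) \<in> segments e \<and> b \<le> t. g b - g a) = g t - g 0"
  unfolding initial_segments
  using finite_division_points ends_in_division_points assms division_points_bounds[OF assms(1)]
  by (intro sum_consecutive_telescope) auto

text \<open>
  Along each old edge the differences of \<open>g\<close> telescope.
\<close>

lemma sum_refined_gradient:
  fixes \<omega> :: "'e \<Rightarrow> 'c::comm_ring_1"
  shows "(\<Sum>h\<in>arcs G'. \<omega> (fst h) * (g (head G' h) - g (tail G' h))) =
    (\<Sum>e\<in>arcs G. \<omega> e * (g (Vertex (head G e)) - g (Vertex (tail G e))))"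
proof -
  have "(\<Sum>(a, b)\<in>segments e. \<omega> e * (g (point_at G len e b) - g (point_at G len e a))) =
      \<omega> e * (g (Vertex (head G e)) - g (Vertex (tail G e)))" if "e \<in> arcs G" for e
    using sum_segments_telescope[OF that, of "\<lambda>t. g (point_at G len e t)"] point_at_ends[OF that]
    by (simp add: sum_distrib_left[symmetric] case_prod_unfold)
  then show ?thesis
    by (simp add: sum_arcs_refine tail_refine head_refine cong: sum.cong)
qed

lemma harmonic_pullback:
  fixes \<omega> :: "'e \<Rightarrow> 'c::comm_ring_1"
  assumes "harmonic G \<omega>"
  shows "harmonic G' (\<lambda>h. \<omega> (fst h))"
proof -
  interpret R: fin_digraph G'
    by (rule fin_digraph_refine)
  show ?thesis
    unfolding R.harmonic_iff_orthogonal_to_gradients sum_refined_gradient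
  proof
    fix g :: "('v,'e) point \<Rightarrow> 'c"
    show "(\<Sum>e\<in>arcs G. \<omega> e * (g (Vertex (head G e)) - g (Vertex (tail G e)))) = 0"
      using harmonic_iff_orthogonal_to_gradients[THEN iffD1, OF assms, THEN spec, of "\<lambda>v. g (Vertex v)"] .
  qed
qed

text \<open>
  Test \<open>\<omega>\<close> against the indicator function of the stretch of \<open>e\<close>
  from \<open>b\<close> to \<open>c\<close>. Its endpoints are interior points of the edge, and its
  gradient is supported on the two given segments.
\<close>

lemma harmonic_refine_constant:
  fixes \<omega> :: "'e \<times> real \<times> real \<Rightarrow> 'c::comm_ring_1"
  assumes "harmonic G' \<omega>" "(e, a, b) \<in> arcs G'" "(e, c, d) \<in> arcs G'" "b \<le> c"
  shows "\<omega> (e, a, b) = \<omega> (e, c, d)"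
proof -
  interpret R: fin_digraph G'
    by (rule fin_digraph_refine)
  define g :: "('v,'e) point \<Rightarrow> 'c" where
    "g = (\<lambda>p. case p of Vertex v \<Rightarrow> 0 | Interior e' t \<Rightarrow> if e' = e \<and> b \<le> t \<and> t \<le> c then 1 else 0)"
  have e: "e \<in> arcs G" and ab: "(a, b) \<in> segments e" and cd: "(c, d) \<in> segments e"
    using assms by (auto simp: in_arcs_refine)
  have bc: "0 < b" "c < len e"
    using ab cd division_points_bounds[OF e] by (auto simp: consecutive_def) (meson order_le_less_trans less_le_trans)+
  have g: "g (point_at G len e' t) = (if e' = e \<and> b \<le> t \<and> t \<le> c then 1 else 0)" for e' t
    using bc by (auto simp: g_def point_at_def)
  \<comment> \<open>the indicator function jumps up exactly on \<open>(a, b)\<close> and down exactly on \<open>(c, d)\<close>\<close>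
  have jump: "(if x = e \<and> b \<le> z \<and> z \<le> c then 1 else 0) - (if x = e \<and> b \<le> y \<and> y \<le> c then 1 else (0::'c)) =
      (if (x, y, z) = (e, a, b) then 1 else 0) - (if (x, y, z) = (e, c, d) then 1 else 0)"
    if "(x, y, z) \<in> arcs G'" for x y z
  proof (cases "x = e")
    case True
    then have yz: "(y, z) \<in> segments e"
      using that by (simp add: in_arcs_refine)
    have less: "a < b" "c < d" "y < z"
      using ab cd yz by (auto simp: consecutive_def)
    have gaps: "\<not> (y < x \<and> x < z) \<and> \<not> (a < x \<and> x < b) \<and> \<not> (c < x \<and> x < d)" if "x \<in> {a, b, c, d, y, z}" for x
      using that ab cd yz unfolding consecutive_def by blast
    have "b \<le> z \<and> z \<le> c \<and> \<not> (b \<le> y \<and> y \<le> c) \<longleftrightarrow> y = a \<and> z = b"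
      using gaps[of a] gaps[of b] gaps[of y] less \<open>b \<le> c\<close> by (smt (verit) insertCI)
    moreover have "b \<le> y \<and> y \<le> c \<and> \<not> (b \<le> z \<and> z \<le> c) \<longleftrightarrow> y = c \<and> z = d"
      using gaps[of c] gaps[of d] gaps[of z] less \<open>b \<le> c\<close> by (smt (verit) insertCI)
    moreover have "\<not> (y = a \<and> z = b \<and> y = c \<and> z = d)"
      using less \<open>b \<le> c\<close> by linarith
    ultimately show ?thesis
      using True by auto
  qed auto
  have "g (head G' h) - g (tail G' h) = (if h = (e, a, b) then 1 else 0) - (if h = (e, c, d) then 1 else 0)"
    if "h \<in> arcs G'" for h
  proof -
    obtain x y z where h: "h = (x, y, z)"
      by (cases h)
    show ?thesis
      using jump[of x y z] that unfolding h tail_refine head_refine g by blast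
  qed
  then have "(\<Sum>h\<in>arcs G'. \<omega> h * (g (head G' h) - g (tail G' h))) =
      (\<Sum>h\<in>arcs G'. \<omega> h * ((if h = (e, a, b) then 1 else 0) - (if h = (e, c, d) then 1 else 0)))"
    by (intro sum.cong refl) simp
  also have "\<dots> = \<omega> (e, a, b) - \<omega> (e, c, d)"
    using assms(2,3) by (simp add: right_diff_distrib sum_subtractf if_distrib[of "\<lambda>x. _ * x"] cong: if_cong)
  finally show ?thesis
    using R.harmonic_iff_orthogonal_to_gradients[THEN iffD1, OF assms(1), THEN spec, of g] by simp
qed

text \<open>
  By constancy \<open>\<omega>\<close> is a pullback. A potential on the old vertices extends by
  zero to the new ones, so harmonicity on the old model follows from the telescoped sum.
\<close>

lemma harmonic_refine_descends:
  fixes \<omega> :: "'e \<times> real \<times> real \<Rightarrow> 'c::comm_ring_1"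
  assumes "harmonic G' \<omega>"
  obtains \<eta> where "harmonic G \<eta>" "\<And>h. h \<in> arcs G' \<Longrightarrow> \<omega> h = \<eta> (fst h)"
proof
  interpret R: fin_digraph G'
    by (rule fin_digraph_refine)
  define \<eta> where "\<eta> = (\<lambda>e. \<omega> (e, SOME s. s \<in> segments e))"
  show eq: "\<omega> h = \<eta> (fst h)" if "h \<in> arcs G'" for h
  proof -
    obtain e a b where h: "h = (e, a, b)"
      by (cases h)
    have e: "e \<in> arcs G" and ab: "(a, b) \<in> segments e"
      using that by (auto simp: h in_arcs_refine)
    obtain c d where cd: "(SOME s. s \<in> segments e) = (c, d)"
      by fastforce
    with ab have cd': "(c, d) \<in> segments e"
      by (metis someI)
    have "b \<le> c \<or> d \<le> a \<or> (a, b) = (c, d)"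
      using ab cd' unfolding consecutive_def by (smt (verit) case_prodD mem_Collect_eq)
    then show ?thesis
      using harmonic_refine_constant[OF assms, of e a b c d] harmonic_refine_constant[OF assms, of e c d a b]
        e ab cd' by (auto simp: \<eta>_def h cd in_arcs_refine)
  qed
  show "harmonic G \<eta>"
    unfolding harmonic_iff_orthogonal_to_gradients
  proof
    fix g :: "'v \<Rightarrow> 'c"
    \<comment> \<open>the values at the new vertices cancel in the telescoping sum\<close>
    let ?g = "\<lambda>p. case p of Vertex v \<Rightarrow> g v | Interior e t \<Rightarrow> 0"
    have "(\<Sum>e\<in>arcs G. \<eta> e * (g (head G e) - g (tail G e))) =
        (\<Sum>h\<in>arcs G'. \<omega> h * (?g (head G' h) - ?g (tail G' h)))"
      using sum_refined_gradient[of \<eta> ?g] eq by (simp cong: sum.cong)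
    also have "\<dots> = 0"
      using R.harmonic_iff_orthogonal_to_gradients[THEN iffD1, OF assms, THEN spec, of ?g] .
    finally show "(\<Sum>e\<in>arcs G. \<eta> e * (g (head G e) - g (tail G e))) = 0" .
  qed
qed

text \<open>
  The chain from the source of \<open>e\<close> to the point at distance \<open>t\<close>, if
  \<open>t\<close> is a division point.
\<close>

definition initial_path :: "'e \<Rightarrow> real \<Rightarrow> ('e \<times> real \<times> real) \<Rightarrow>\<^sub>0 int" where
  "initial_path e t = (\<Sum>(a, b) | (a, b) \<in> segments e \<and> b \<le> t. frag_of (e, a, b))"

lemma finite_initial_segments: "finite {(a, b). (a, b) \<in> segments e \<and> b \<le> t}"
  by (rule finite_subset[OF _ finite_consecutive[OF finite_division_points]]) auto

lemma initial_path_closed: "e \<in> arcs G \<Longrightarrow> initial_path e t \<in> carrier (C01 G')"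
  unfolding initial_path_def C01_def
  by (rule sum_closed_free_Abelian_group) (auto simp: in_arcs_refine split: if_splits)

lemma path_bd_initial_path:
  assumes "e \<in> arcs G" "t \<in> division_points len S e"
  shows "path_bd G' (initial_path e t) = frag_of (point_at G len e t) - frag_of (Vertex (tail G e))"
proof -
  have "path_bd G' (initial_path e t) =
      (\<Sum>(a, b) | (a, b) \<in> segments e \<and> b \<le> t. frag_of (point_at G len e b) - frag_of (point_at G len e a))"
    unfolding initial_path_def
    by (subst path_bd_sum[OF finite_initial_segments])
       (auto intro!: sum.cong simp: path_bd_of tail_refine head_refine)
  then show ?thesis
    using sum_initial_segments_telescope[OF assms, of "\<lambda>t. frag_of (point_at G len e t)"]
    by (simp add: point_at_ends[OF assms(1)])
qed

lemma lookup_initial_path: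
  "Poly_Mapping.lookup (initial_path e t) (e', a, b) = (if e = e' \<and> (a, b) \<in> segments e \<and> b \<le> t then 1 else 0)"
proof -
  have "Poly_Mapping.lookup (initial_path e t) (e', a, b) =
      (\<Sum>s | case s of (a, b) \<Rightarrow> (a, b) \<in> segments e \<and> b \<le> t. if (e, s) = (e', a, b) then 1 else 0)"
    unfolding initial_path_def lookup_sum by (intro sum.cong refl) auto
  also have "\<dots> = (if e = e' \<and> (a, b) \<in> segments e \<and> b \<le> t then 1 else 0)"
    using finite_initial_segments[of e t] by (cases "e = e'") auto
  finally show ?thesis .
qed

lemma chain_subdivision:
  assumes "\<gamma> \<in> carrier (C01 G)" "path_bd G \<gamma> = frag_of v - frag_of u"
  shows "\<exists>\<gamma>'\<in>carrier (C01 G'). path_bd G' \<gamma>' = frag_of (Vertex v) - frag_of (Vertex u)"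
proof
  let ?V = "frag_extend (\<lambda>v. frag_of (Vertex v))"
  let ?K = "Poly_Mapping.keys \<gamma>"
  let ?\<gamma>' = "\<Sum>e\<in>?K. frag_cmul (Poly_Mapping.lookup \<gamma> e) (initial_path e (len e))"
  have K: "?K \<subseteq> arcs G"
    using assms by (simp add: carrier_C01)
  show "?\<gamma>' \<in> carrier (C01 G')"
    unfolding C01_def using K initial_path_closed
    by (intro sum_closed_free_Abelian_group) (force simp: C01_def dest: subsetD[OF keys_cmul])
  have "path_bd G' ?\<gamma>' = (\<Sum>e\<in>?K. frag_cmul (Poly_Mapping.lookup \<gamma> e)
      (frag_of (Vertex (head G e)) - frag_of (Vertex (tail G e))))"
    using K by (subst path_bd_sum)
      (auto intro!: sum.cong simp: path_bd_cmul path_bd_initial_path ends_in_division_points point_at_ends)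
  also have "\<dots> = ?V (path_bd G \<gamma>)"
    by (simp add: path_bd_def frag_extend_def[of _ \<gamma>] frag_extend_sum frag_extend_cmul frag_extend_diff)
  also have "\<dots> = frag_of (Vertex v) - frag_of (Vertex u)"
    by (simp add: assms frag_extend_diff)
  finally show "path_bd G' ?\<gamma>' = frag_of (Vertex v) - frag_of (Vertex u)" .
qed

lemma chain_connected_refine: "chain_connected G'"
proof -
  interpret R: fin_digraph G'
    by (rule fin_digraph_refine)
  define joined where
    "joined p q \<longleftrightarrow> (\<exists>\<gamma>\<in>carrier (C01 G'). path_bd G' \<gamma> = frag_of q - frag_of p)" for p q
  have sym: "joined q p" if "joined p q" for p q
  proof -
    from that obtain \<gamma> where "\<gamma> \<in> carrier (C01 G')" "path_bd G' \<gamma> = frag_of q - frag_of p"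
      by (auto simp: joined_def)
    then show ?thesis
      unfolding joined_def by (intro bexI[of _ "- \<gamma>"]) (simp_all add: path_bd_minus carrier_C01)
  qed
  have trans: "joined p r" if "joined p q" "joined q r" for p q r
  proof -
    from that obtain \<gamma> \<gamma>' where "\<gamma> \<in> carrier (C01 G')" "path_bd G' \<gamma> = frag_of q - frag_of p"
      "\<gamma>' \<in> carrier (C01 G')" "path_bd G' \<gamma>' = frag_of r - frag_of q"
      by (auto simp: joined_def)
    then show ?thesis
      unfolding joined_def using keys_add[of \<gamma> \<gamma>']
      by (intro bexI[of _ "\<gamma> + \<gamma>'"]) (auto simp: path_bd_add carrier_C01)
  qed
  have old: "\<exists>v\<in>verts G. joined (Vertex v) p" if p: "p \<in> verts G'" for p
  proof (cases p)
    case (Vertex v)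
    moreover have "joined p p"
      unfolding joined_def by (intro bexI[of _ 0]) (simp_all add: path_bd_zero carrier_C01)
    moreover have "v \<in> verts G"
      using p Vertex S_subset by (auto simp: verts_refine curve_points_def)
    ultimately show ?thesis
      by blast
  next
    case (Interior e t)
    then have "Interior e t \<in> S"
      using p by (auto simp: verts_refine)
    then have e: "e \<in> arcs G" "t \<in> division_points len S e" "point_at G len e t = p"
      using Interior_in_S[of e t] by (auto simp: division_points_def point_at_def Interior)
    then have "joined (Vertex (tail G e)) p"
      unfolding joined_def using path_bd_initial_path[OF e(1,2)] initial_path_closed[OF e(1)] by auto
    then show ?thesis
      using e(1) by auto
  qed
  have base: "joined (Vertex u) (Vertex v)" if "u \<in> verts G" "v \<in> verts G" for u v
    using chain_exists[OF that] chain_subdivision by (auto simp: joined_def)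
  have "joined p q" if "p \<in> verts G'" "q \<in> verts G'" for p q
    using old[OF that(1)] old[OF that(2)] base sym trans by meson
  then show ?thesis
    by unfold_locales (auto simp: joined_def)
qed

end

sublocale refined_model \<subseteq> R: chain_connected "refine G len S"
  by (rule chain_connected_refine)

section \<open>Invariance under refinement\<close>

context refined_model
begin

text \<open>
  Dual to the pullback of forms: pairing with a pullback is pairing the push-forward.
\<close>

definition push_forward :: "('e \<times> real \<times> real \<Rightarrow> real) \<Rightarrow> 'e \<Rightarrow> real" where
  "push_forward c e = (\<Sum>(a, b)\<in>segments e. c (e, a, b))"

lemma push_forward_add: "push_forward (\<lambda>h. c h + d h) e = push_forward c e + push_forward d e"
  and push_forward_uminus: "push_forward (\<lambda>h. - c h) e = - push_forward c e"
  by (simp_all add: push_forward_def case_prod_unfold sum.distrib sum_negf)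

lemma sum_push_forward: "(\<Sum>h\<in>arcs G'. c h * \<omega> (fst h)) = (\<Sum>e\<in>arcs G. push_forward c e * \<omega> e)"
  by (simp add: sum_arcs_refine push_forward_def sum_distrib_right case_prod_unfold)

lemma Omega_refine: "Omega G' = (\<lambda>\<omega>. \<lambda>h\<in>arcs G'. \<omega> (fst h)) ` Omega G"
proof (intro subset_antisym image_subsetI subsetI)
  fix \<omega> assume "\<omega> \<in> Omega G"
  then show "(\<lambda>h\<in>arcs G'. \<omega> (fst h)) \<in> Omega G'"
    by (simp add: R.Omega_iff Omega_iff harmonic_pullback cong: harmonic_cong)
next
  fix \<omega>' assume \<omega>': "\<omega>' \<in> Omega G'"
  then have "harmonic G' \<omega>'"
    by (simp add: R.Omega_iff)
  then obtain \<eta> where \<eta>: "harmonic G \<eta>" "\<And>h. h \<in> arcs G' \<Longrightarrow> \<omega>' h = \<eta> (fst h)"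
    by (rule harmonic_refine_descends) blast
  have "restrict \<eta> (arcs G) \<in> Omega G"
    using \<eta>(1) by (simp add: Omega_iff cong: harmonic_cong)
  moreover have "\<omega>' = (\<lambda>h\<in>arcs G'. restrict \<eta> (arcs G) (fst h))"
    using \<omega>' \<eta>(2) by (intro extensionalityI[of _ "arcs G'"]) (auto simp: R.Omega_iff in_arcs_refine)
  ultimately show "\<omega>' \<in> (\<lambda>\<omega>. \<lambda>h\<in>arcs G'. \<omega> (fst h)) ` Omega G"
    by blast
qed

lemma functional_refine_eq_iff:
  "functional G' c = functional G' d \<longleftrightarrow> functional G (push_forward c) = functional G (push_forward d)"
proof -
  have "(\<Sum>h\<in>arcs G'. c h * (\<lambda>h\<in>arcs G'. \<omega> (fst h)) h) = (\<Sum>e\<in>arcs G. push_forward c e * \<omega> e)" for c \<omega>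
    by (simp add: sum_push_forward[symmetric] cong: sum.cong)
  then show ?thesis
    by (simp add: functional_eq_on_Omega Omega_refine)
qed

lemma push_forward_period_vector_lift:
  assumes "e \<in> arcs G" "\<And>h. h \<in> arcs G' \<Longrightarrow> Poly_Mapping.lookup \<gamma>' h = Poly_Mapping.lookup \<gamma> (fst h)"
  shows "push_forward (period_vector refine_len \<gamma>') e = period_vector len \<gamma> e"
proof -
  have "push_forward (period_vector refine_len \<gamma>') e =
      (\<Sum>(a, b)\<in>segments e. of_int (Poly_Mapping.lookup \<gamma> e) * (b - a))"
    unfolding push_forward_def using assms by (intro sum.cong refl) (auto simp: refine_len_def in_arcs_refine)
  also have "\<dots> = of_int (Poly_Mapping.lookup \<gamma> e) * (len e - 0)"
    using sum_segments_telescope[OF assms(1), of "\<lambda>t. t"]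
    by (simp add: case_prod_unfold sum_distrib_left[symmetric])
  finally show ?thesis
    by simp
qed

lemma H01_refine_descends:
  assumes "\<gamma>' \<in> H01 G'"
  obtains \<gamma> where "\<gamma> \<in> H01 G" "\<And>h. h \<in> arcs G' \<Longrightarrow> Poly_Mapping.lookup \<gamma>' h = Poly_Mapping.lookup \<gamma> (fst h)"
proof -
  from assms have "harmonic G' (Poly_Mapping.lookup \<gamma>')"
    by (simp add: R.H01_iff)
  then obtain \<eta> where \<eta>: "harmonic G \<eta>" "\<And>h. h \<in> arcs G' \<Longrightarrow> Poly_Mapping.lookup \<gamma>' h = \<eta> (fst h)"
    by (rule harmonic_refine_descends) blast
  obtain \<gamma> where \<gamma>: "Poly_Mapping.keys \<gamma> \<subseteq> arcs G" "\<forall>e\<in>arcs G. Poly_Mapping.lookup \<gamma> e = \<eta> e"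
    using exists_frag[OF finite_arcs, of \<eta>] by blast
  then have "\<gamma> \<in> H01 G"
    using \<eta>(1) by (simp add: H01_iff carrier_C01 cong: harmonic_cong)
  moreover have "Poly_Mapping.lookup \<gamma>' h = Poly_Mapping.lookup \<gamma> (fst h)" if "h \<in> arcs G'" for h
    using that \<eta>(2) \<gamma>(2) by (auto simp: arcs_refine)
  ultimately show thesis
    by (rule that)
qed

lemma H01_refine_lifts:
  assumes "\<gamma> \<in> H01 G"
  obtains \<gamma>' where "\<gamma>' \<in> H01 G'" "\<And>h. h \<in> arcs G' \<Longrightarrow> Poly_Mapping.lookup \<gamma>' h = Poly_Mapping.lookup \<gamma> (fst h)"
proof -
  obtain \<gamma>' where \<gamma>': "Poly_Mapping.keys \<gamma>' \<subseteq> arcs G'"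
    "\<forall>h\<in>arcs G'. Poly_Mapping.lookup \<gamma>' h = Poly_Mapping.lookup \<gamma> (fst h)"
    using exists_frag[OF R.finite_arcs, of "\<lambda>h. Poly_Mapping.lookup \<gamma> (fst h)"] by blast
  moreover have "harmonic G' (\<lambda>h. Poly_Mapping.lookup \<gamma> (fst h))"
    using assms by (simp add: H01_iff harmonic_pullback)
  ultimately have "\<gamma>' \<in> H01 G'"
    by (simp add: R.H01_iff carrier_C01 cong: harmonic_cong)
  with \<gamma>'(2) show thesis
    by (intro that) auto
qed

text \<open>
  Cycles of the two models correspond, and the segment lengths of an edge add up to its length, so
  the period lattices correspond under the push-forward.
\<close>

lemma Jac_class_refine_eq_iff:
  "Jac_class G' refine_len (functional G' c) = Jac_class G' refine_len (functional G' d) \<longleftrightarrow>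
    Jac_class G len (functional G (push_forward c)) = Jac_class G len (functional G (push_forward d))"
proof -
  have lift: "functional G (push_forward (\<lambda>h. period_vector refine_len \<gamma>' h + d h)) =
      functional G (\<lambda>e. period_vector len \<gamma> e + push_forward d e)"
    if "\<And>h. h \<in> arcs G' \<Longrightarrow> Poly_Mapping.lookup \<gamma>' h = Poly_Mapping.lookup \<gamma> (fst h)" for \<gamma> \<gamma>'
    using that by (intro functional_cong) (simp add: push_forward_add push_forward_period_vector_lift)
  show ?thesis
    unfolding Jac_class_eq_iff R.Jac_class_eq_iff functional_refine_eq_iff
  proof
    assume "\<exists>\<gamma>'\<in>H01 G'. functional G (push_forward c) = functional G (push_forward (\<lambda>h. period_vector refine_len \<gamma>' h + d h))"
    then obtain \<gamma>' where \<gamma>': "\<gamma>' \<in> H01 G'"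
      "functional G (push_forward c) = functional G (push_forward (\<lambda>h. period_vector refine_len \<gamma>' h + d h))"
      by blast
    obtain \<gamma> where l: "\<gamma> \<in> H01 G" "\<And>h. h \<in> arcs G' \<Longrightarrow> Poly_Mapping.lookup \<gamma>' h = Poly_Mapping.lookup \<gamma> (fst h)"
      using \<gamma>'(1) by (rule H01_refine_descends) blast
    have "functional G (push_forward c) = functional G (\<lambda>e. period_vector len \<gamma> e + push_forward d e)"
      unfolding \<gamma>'(2) by (rule lift[OF l(2)])
    with l(1) show "\<exists>\<gamma>\<in>H01 G. functional G (push_forward c) = functional G (\<lambda>e. period_vector len \<gamma> e + push_forward d e)" ..
  next
    assume "\<exists>\<gamma>\<in>H01 G. functional G (push_forward c) = functional G (\<lambda>e. period_vector len \<gamma> e + push_forward d e)"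
    then obtain \<gamma> where \<gamma>: "\<gamma> \<in> H01 G"
      "functional G (push_forward c) = functional G (\<lambda>e. period_vector len \<gamma> e + push_forward d e)"
      by blast
    obtain \<gamma>' where l: "\<gamma>' \<in> H01 G'" "\<And>h. h \<in> arcs G' \<Longrightarrow> Poly_Mapping.lookup \<gamma>' h = Poly_Mapping.lookup \<gamma> (fst h)"
      using \<gamma>(1) by (rule H01_refine_lifts) blast
    have "functional G (push_forward c) = functional G (push_forward (\<lambda>h. period_vector refine_len \<gamma>' h + d h))"
      unfolding \<gamma>(2) by (rule lift[OF l(2), symmetric])
    with l(1) show "\<exists>\<gamma>'\<in>H01 G'. functional G (push_forward c) = functional G (push_forward (\<lambda>h. period_vector refine_len \<gamma>' h + d h))" ..
  qed
qed

text \<open>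
  An end of a segment carries the value of the old end on which it lies; the ends at new vertices
  carry zero.
\<close>

definition refine_ends :: "('e \<times> side \<Rightarrow> real) \<Rightarrow> ('e \<times> real \<times> real) \<times> side \<Rightarrow> real" where
  "refine_ends y = (\<lambda>((e, a, b), d).
     if (case d of Source \<Rightarrow> a = 0 | Target \<Rightarrow> b = len e) then y (e, d) else 0)"

lemma segment_bounds:
  assumes "e \<in> arcs G" "(a, b) \<in> segments e"
  shows "0 \<le> a" "a < b" "b \<le> len e"
  using assms division_points_bounds[OF assms(1)] by (auto simp: consecutive_def)

lemma ends_at_refine_Vertex:
  assumes "h \<in> ends_at G' (Vertex v)"
  shows "(fst (fst h), snd h) \<in> ends_at G v" "refine_ends y h = y (fst (fst h), snd h)"
proof -
  obtain e a b d where h: "h = ((e, a, b), d)"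
    by (cases h) auto
  have "e \<in> arcs G" "(a, b) \<in> segments e"
    using assms by (auto simp: h ends_at_def in_arcs_refine)
  note bounds = segment_bounds[OF this]
  show "(fst (fst h), snd h) \<in> ends_at G v" "refine_ends y h = y (fst (fst h), snd h)"
    using assms bounds \<open>e \<in> arcs G\<close>
    by (auto simp: h ends_at_def tail_refine head_refine point_at_def refine_ends_def split: if_splits)
qed

lemma ends_at_refine_Interior:
  assumes "h \<in> ends_at G' (Interior e' t)"
  shows "refine_ends y h = 0"
  using assms by (cases h) (auto simp: ends_at_def tail_refine head_refine point_at_def refine_ends_def split: if_splits)

lemma refine_C10_chain_class: "refine_C10 G len S (chain_class G y) = chain_class G' (refine_ends y)"
proof (rule extensionalityI[of _ "verts G'"])
  fix p assume p: "p \<in> verts G'"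
  show "refine_C10 G len S (chain_class G y) p = chain_class G' (refine_ends y) p"
  proof (cases p)
    case (Vertex v)
    then have v: "v \<in> verts G"
      using p S_subset by (auto simp: verts_refine curve_points_def)
    have "(\<lambda>x. \<lambda>h\<in>ends_at G' p. x (fst (fst h), snd h)) ` F1_class G v (restrict y (ends_at G v)) =
        F1_class G' p (restrict (refine_ends y) (ends_at G' p))"
      unfolding F1_class_eq image_image
      by (intro image_cong refl restrict_ext) (simp add: Vertex ends_at_refine_Vertex)
    then show ?thesis
      using p v by (simp add: refine_C10_def Let_def Vertex chain_class_def)
  next
    case (Interior e t)
    have "balancing_line G' p = F1_class G' p (restrict (refine_ends y) (ends_at G' p))"
      unfolding F1_class_eq balancing_line_def
      by (intro image_cong refl restrict_ext) (simp add: Interior ends_at_refine_Interior)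
    then show ?thesis
      using p by (simp add: refine_C10_def Let_def Interior chain_class_def F1_def)
  qed
qed (simp_all add: refine_C10_def Let_def chain_class_def)

text \<open>
  Exactly one segment of \<open>e\<close> starts at \<open>0\<close> and exactly one ends at
  \<open>len e\<close>.
\<close>

lemma push_forward_end_sum_refine_ends:
  assumes "e \<in> arcs G"
  shows "push_forward (end_sum (refine_ends y)) e = end_sum y e"
proof -
  \<comment> \<open>chosen so that the increment over a segment is the contribution of its two ends\<close>
  let ?s = "\<lambda>t::real. if t = 0 then 0 else y (e, Source)"
  let ?t = "\<lambda>t::real. if t = len e then y (e, Target) else 0"
  have "push_forward (end_sum (refine_ends y)) e = (\<Sum>(a, b)\<in>segments e. (?s b + ?t b) - (?s a + ?t a))"
    unfolding push_forward_def
    using segment_bounds[OF assms] by (intro sum.cong refl) (auto simp: end_sum_def refine_ends_def, force+)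
  also have "\<dots> = end_sum y e"
    using sum_segments_telescope[OF assms, of "\<lambda>t. ?s t + ?t t"] len_pos[OF assms] by (simp add: end_sum_def)
  finally show ?thesis .
qed

text \<open>
  The condition that characterises \<open>AJ(D)\<close> on the refinement, expressed on the original
  model.
\<close>

lemma JH10_class_refine_eq_iff:
  "JH10_class G' refine_len (refine_C10 G len S (chain_class G y)) =
      JH10_class G' refine_len (monodromy G' refine_len \<gamma>) \<longleftrightarrow>
    Jac_class G len (functional G (end_sum y)) =
      Jac_class G len (functional G (push_forward (period_vector refine_len \<gamma>)))"
proof -
  have "functional G (push_forward (end_sum (refine_ends y))) = functional G (end_sum y)"
    by (intro functional_cong push_forward_end_sum_refine_ends)
  then show ?thesis
    unfolding refine_C10_chain_class monodromy_eq R.JH10_class_eq_iff Jac_class_refine_eq_iff end_sum_monodromy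
    by simp
qed

lemma integral1_refine:
  "(\<lambda>\<omega>\<in>Omega G. integral1 G' refine_len \<gamma> (\<omega> \<circ> fst)) = functional G (push_forward (period_vector refine_len \<gamma>))"
proof -
  have "integral1 G' refine_len \<gamma> (\<omega> \<circ> fst) = (\<Sum>e\<in>arcs G. push_forward (period_vector refine_len \<gamma>) e * \<omega> e)" for \<omega>
    by (simp add: integral1_def sum_push_forward[symmetric] mult.assoc)
  then show ?thesis
    by (simp add: functional_def)
qed

text \<open>
  Two chains with the same boundary differ by a cycle, whose integral is a period.
\<close>

lemma Jac_class_integral_cong:
  assumes "\<gamma> \<in> carrier (C01 G')" "\<gamma>' \<in> carrier (C01 G')" "path_bd G' \<gamma> = path_bd G' \<gamma>'"
  shows "Jac_class G len (functional G (push_forward (period_vector refine_len \<gamma>))) =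
    Jac_class G len (functional G (push_forward (period_vector refine_len \<gamma>')))"
proof -
  have "\<gamma> - \<gamma>' \<in> carrier (C01 G')"
    using assms keys_diff[of \<gamma> \<gamma>'] by (auto simp: carrier_C01)
  then have "\<gamma> - \<gamma>' \<in> H01 G'"
    using assms(3) by (simp add: R.H01_iff R.path_bd_eq_0_iff[symmetric] path_bd_diff)
  moreover have "functional G' (period_vector refine_len \<gamma>) =
      functional G' (\<lambda>h. period_vector refine_len (\<gamma> - \<gamma>') h + period_vector refine_len \<gamma>' h)"
    by (intro functional_cong) (simp add: lookup_minus algebra_simps)
  ultimately have "Jac_class G' refine_len (functional G' (period_vector refine_len \<gamma>)) =
      Jac_class G' refine_len (functional G' (period_vector refine_len \<gamma>'))"
    unfolding R.Jac_class_eq_iff by (rule bexI[rotated])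
  then show ?thesis
    by (simp add: Jac_class_refine_eq_iff)
qed

lemma period_vector_uminus: "period_vector l (- \<gamma>) = (\<lambda>e. - period_vector l \<gamma> e)"
  by (simp add: fun_eq_iff)

lemma classical_AJ_eq:
  assumes S: "S = Poly_Mapping.keys D" and \<gamma>: "\<gamma> \<in> carrier (C01 G')" "path_bd G' \<gamma> = D"
  shows "classical_AJ G len D = Jac_class G len (functional G (push_forward (period_vector refine_len \<gamma>)))"
  unfolding classical_AJ_def Let_def S[symmetric] integral1_refine
proof (rule the_equality)
  show "\<exists>\<gamma>'\<in>carrier (C01 G'). path_bd G' \<gamma>' = D \<and>
      Jac_class G len (functional G (push_forward (period_vector refine_len \<gamma>))) =
      Jac_class G len (functional G (push_forward (period_vector refine_len \<gamma>')))"
    using \<gamma> by blast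
  fix c
  assume "\<exists>\<gamma>'\<in>carrier (C01 G'). path_bd G' \<gamma>' = D \<and>
      c = Jac_class G len (functional G (push_forward (period_vector refine_len \<gamma>')))"
  then show "c = Jac_class G len (functional G (push_forward (period_vector refine_len \<gamma>)))"
    using Jac_class_integral_cong[OF _ \<gamma>(1)] \<gamma>(2) by auto
qed

text \<open>
  The chain \<open>-\<gamma>\<close> has tropical boundary \<open>D\<close>, which turns the class
  of \<open>\<gamma>\<close> into that of \<open>source_chain\<close>.
\<close>

lemma AJ_eq:
  assumes S: "S = Poly_Mapping.keys D" and \<gamma>: "\<gamma> \<in> carrier (C01 G')" "path_bd G' \<gamma> = D"
  shows "AJ G len D = JH10_class G len (chain_class G (source_chain (push_forward (period_vector refine_len \<gamma>))))"
    (is "_ = JH10_class G len (chain_class G ?y)")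
  unfolding AJ_def Let_def S[symmetric]
proof (rule the_equality)
  have neg: "functional G (push_forward (period_vector refine_len (- \<gamma>'))) =
      functional G (\<lambda>e. - push_forward (period_vector refine_len \<gamma>') e)" for \<gamma>'
    unfolding period_vector_uminus by (rule functional_cong) (rule push_forward_uminus)
  show "\<exists>X\<in>carrier (C10 G). \<exists>\<gamma>\<in>carrier (C01 G'). bd0 G' \<gamma> = D \<and>
      JH10_class G len (chain_class G ?y) = JH10_class G len X \<and>
      JH10_class G' refine_len (refine_C10 G len S X) = JH10_class G' refine_len (monodromy G' refine_len \<gamma>)"
  proof (intro bexI conjI)
    show "bd0 G' (- \<gamma>) = D"
      using \<gamma> by (simp add: bd0_eq path_bd_minus)
    show "JH10_class G' refine_len (refine_C10 G len S (chain_class G ?y)) =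
        JH10_class G' refine_len (monodromy G' refine_len (- \<gamma>))"
      unfolding JH10_class_refine_eq_iff end_sum_source_chain neg ..
    show "- \<gamma> \<in> carrier (C01 G')"
      using \<gamma> by (simp add: carrier_C01)
  qed simp_all
  fix c
  assume "\<exists>X\<in>carrier (C10 G). \<exists>\<gamma>\<in>carrier (C01 G'). bd0 G' \<gamma> = D \<and> c = JH10_class G len X \<and>
      JH10_class G' refine_len (refine_C10 G len S X) = JH10_class G' refine_len (monodromy G' refine_len \<gamma>)"
  then obtain X \<gamma>' where X: "X \<in> carrier (C10 G)" and \<gamma>': "\<gamma>' \<in> carrier (C01 G')" "bd0 G' \<gamma>' = D"
    and c: "c = JH10_class G len X"
    and eq: "JH10_class G' refine_len (refine_C10 G len S X) = JH10_class G' refine_len (monodromy G' refine_len \<gamma>')"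
    by blast
  obtain y where y: "X = chain_class G y"
    using X by (rule C10_cases)
  have "path_bd G' (- \<gamma>) = path_bd G' \<gamma>'"
    using \<gamma>(2) \<gamma>'(2) by (simp add: bd0_eq path_bd_minus minus_equation_iff)
  then have "Jac_class G len (functional G (push_forward (period_vector refine_len (- \<gamma>)))) =
      Jac_class G len (functional G (push_forward (period_vector refine_len \<gamma>')))"
    using \<gamma>(1) \<gamma>'(1) by (intro Jac_class_integral_cong) (simp_all add: carrier_C01)
  then have "Jac_class G len (functional G (end_sum y)) = Jac_class G len (functional G (end_sum ?y))"
    using eq[unfolded y JH10_class_refine_eq_iff] by (simp only: neg end_sum_source_chain)
  then show "c = JH10_class G len (chain_class G ?y)"
    by (simp add: c y JH10_class_eq_iff)
qed

end

section \<open>The Abel--Jacobi maps\<close>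

definition divisor_degree :: "('a \<Rightarrow>\<^sub>0 int) \<Rightarrow> int" where
  "divisor_degree D = (\<Sum>x\<in>Poly_Mapping.keys D. Poly_Mapping.lookup D x)"

text \<open>
  In this form additivity of the degree is that of \<open>frag_extend\<close>.
\<close>

lemma divisor_degree_eq: "divisor_degree D = Poly_Mapping.lookup (frag_extend (\<lambda>_. frag_of ()) D) ()"
  by (simp add: divisor_degree_def frag_extend_def lookup_sum)

text \<open>
  Join the base vertex to each point of the support; the multiple of the base vertex in the boundary
  is the degree.
\<close>

lemma (in chain_connected) chain_with_boundary:
  assumes "Poly_Mapping.keys D \<subseteq> verts G" "divisor_degree D = 0"
  obtains \<gamma> where "\<gamma> \<in> carrier (C01 G)" "path_bd G \<gamma> = D"
proof
  let ?\<gamma> = "\<Sum>x\<in>Poly_Mapping.keys D. frag_cmul (Poly_Mapping.lookup D x) (base_chain x)"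
  show "?\<gamma> \<in> carrier (C01 G)"
    unfolding C01_def using assms(1) base_chain_closed
    by (intro sum_closed_free_Abelian_group) (force simp: C01_def dest: subsetD[OF keys_cmul])
  have "path_bd G ?\<gamma> = (\<Sum>x\<in>Poly_Mapping.keys D. frag_cmul (Poly_Mapping.lookup D x) (frag_of x - frag_of base_vertex))"
    using assms(1) by (subst path_bd_sum) (auto simp: path_bd_cmul path_bd_base_chain intro!: sum.cong)
  also have "\<dots> = D"
  proof (rule poly_mapping_eqI)
    fix z
    let ?K = "Poly_Mapping.keys D"
    have "Poly_Mapping.lookup (\<Sum>x\<in>?K. frag_cmul (Poly_Mapping.lookup D x) (frag_of x - frag_of base_vertex)) z =
        (\<Sum>x\<in>?K. Poly_Mapping.lookup D x * (if z = x then 1 else 0)) - divisor_degree D * (if z = base_vertex then 1 else 0)"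
      by (simp add: lookup_sum lookup_minus divisor_degree_def sum_distrib_right right_diff_distrib sum_subtractf)
    also have "(\<Sum>x\<in>?K. Poly_Mapping.lookup D x * (if z = x then 1 else 0)) = Poly_Mapping.lookup D z"
      by (simp add: if_distrib[of "\<lambda>x. _ * x"] in_keys_iff cong: if_cong)
    finally show "Poly_Mapping.lookup (\<Sum>x\<in>?K. frag_cmul (Poly_Mapping.lookup D x) (frag_of x - frag_of base_vertex)) z =
        Poly_Mapping.lookup D z"
      by (simp add: assms(2))
  qed
  finally show "path_bd G ?\<gamma> = D" .
qed

lemma Div0_iff: "D \<in> Div0 G len \<longleftrightarrow> Poly_Mapping.keys D \<subseteq> curve_points G len \<and> divisor_degree D = 0"
  by (simp add: Div0_def divisor_degree_def)

lemma refined_model_Div0: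
  assumes "chain_connected G" "\<forall>e\<in>arcs G. 0 < len e" "D \<in> Div0 G len"
  shows "refined_model G len (Poly_Mapping.keys D)"
proof -
  interpret chain_connected G
    by (rule assms(1))
  show ?thesis
    using assms by unfold_locales (auto simp: Div0_iff)
qed

text \<open>
  Compute both Abel--Jacobi classes with the same chain on the refinement.
\<close>

lemma Jac_to_JH10_classical_AJ:
  assumes "chain_connected G" "\<forall>e\<in>arcs G. 0 < len e" "D \<in> Div0 G len"
  shows "chain_connected.Jac_to_JH10 G len (classical_AJ G len D) = AJ G len D"
proof -
  interpret refined_model G len "Poly_Mapping.keys D"
    by (rule refined_model_Div0[OF assms])
  have "Poly_Mapping.keys D \<subseteq> verts G'"
    by (simp add: verts_refine)
  then obtain \<gamma> where \<gamma>: "\<gamma> \<in> carrier (C01 G')" "path_bd G' \<gamma> = D"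
    using assms(3) by (auto simp: Div0_iff intro: R.chain_with_boundary)
  show ?thesis
    by (simp add: classical_AJ_eq[OF refl \<gamma>] AJ_eq[OF refl \<gamma>] Jac_to_JH10_Jac_class JH10_class_dual_to_chain)
qed

lemma exists_multiple_in_interval:
  fixes c l :: real
  assumes "0 < l"
  shows "\<exists>n t. of_int n * t = c \<and> 0 < t \<and> t < l"
proof (cases "c = 0")
  case True
  then show ?thesis
    using assms by (intro exI[of _ 0] exI[of _ "l / 2"]) simp
next
  case False
  obtain m :: nat where m: "\<bar>c\<bar> / l < of_nat m"
    using reals_Archimedean2 by blast
  moreover have "0 < \<bar>c\<bar> / l"
    using False assms by simp
  ultimately have pos: "0 < real m"
    by linarith
  have "of_int (if c < 0 then - int m else int m) * (\<bar>c\<bar> / real m) = c"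
    using pos by (simp add: abs_if)
  moreover have "0 < \<bar>c\<bar> / real m" "\<bar>c\<bar> / real m < l"
    using False pos m assms by (simp_all add: field_simps)
  ultimately show ?thesis
    by blast
qed

text \<open>
  Given coordinates \<open>x\<close>, write \<open>x e = n t\<close> with an integer
  \<open>n\<close> and \<open>0 < t < len e\<close>, and move \<open>n\<close> points from the
  source of \<open>e\<close> to the point at distance \<open>t\<close>, for each edge
  \<open>e\<close>.
\<close>

lemma classical_AJ_surj:
  assumes "chain_connected G" "\<forall>e\<in>arcs G. 0 < len e" "c \<in> carrier (Jac G len)"
  shows "\<exists>D\<in>Div0 G len. classical_AJ G len D = c"
proof -
  interpret chain_connected G
    by (rule assms(1))
  obtain x where x: "c = Jac_class G len (functional G x)"
    using assms(3) by (auto simp: carrier_Jac elim: Omega_dual_cases)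
  have "\<forall>e\<in>arcs G. \<exists>n t. of_int n * t = x e \<and> 0 < t \<and> t < len e"
    using assms(2) exists_multiple_in_interval by blast
  then obtain n t where nt: "\<And>e. e \<in> arcs G \<Longrightarrow> of_int (n e) * t e = x e \<and> 0 < t e \<and> t e < len e"
    by metis
  define D where "D = (\<Sum>e\<in>arcs G. frag_cmul (n e) (frag_of (Interior e (t e)) - frag_of (Vertex (tail G e))))"
  have "D \<in> carrier (free_Abelian_group (curve_points G len))"
    unfolding D_def
  proof (rule sum_closed_free_Abelian_group)
    fix e assume e: "e \<in> arcs G"
    have "Poly_Mapping.keys (frag_of (Interior e (t e)) - frag_of (Vertex (tail G e))) \<subseteq> curve_points G len"
      using keys_diff[of "frag_of (Interior e (t e))" "frag_of (Vertex (tail G e))"] e nt[OF e]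
      by (auto simp: curve_points_def)
    then show "frag_cmul (n e) (frag_of (Interior e (t e)) - frag_of (Vertex (tail G e)))
        \<in> carrier (free_Abelian_group (curve_points G len))"
      using keys_cmul[of "n e"] by (meson carrier_free_Abelian_group_iff order_trans)
  qed
  moreover have "divisor_degree D = 0"
    by (simp add: divisor_degree_eq D_def frag_extend_sum frag_extend_cmul frag_extend_diff lookup_sum)
  ultimately have D: "D \<in> Div0 G len"
    by (simp add: Div0_iff)
  interpret refined_model G len "Poly_Mapping.keys D"
    by (rule refined_model_Div0[OF assms(1,2) D])
  \<comment> \<open>if \<open>n e = 0\<close>, then \<open>t e\<close> need not be a division point, but the edge contributes nothing\<close>
  have t_div: "t e \<in> division_points len (Poly_Mapping.keys D) e" if e: "e \<in> arcs G" "n e \<noteq> 0" for e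
  proof -
    have "Poly_Mapping.lookup D (Interior e (t e)) = (\<Sum>e'\<in>arcs G. if e' = e then n e' else 0)"
      unfolding D_def lookup_sum by (intro sum.cong refl) (auto simp: lookup_minus)
    then have "Interior e (t e) \<in> Poly_Mapping.keys D"
      using e by (simp add: in_keys_iff)
    then show ?thesis
      by (simp add: division_points_def)
  qed
  define \<gamma> where "\<gamma> = (\<Sum>e\<in>arcs G. frag_cmul (n e) (initial_path e (t e)))"
  have \<gamma>: "\<gamma> \<in> carrier (C01 G')"
    unfolding \<gamma>_def C01_def using initial_path_closed
    by (intro sum_closed_free_Abelian_group) (force simp: C01_def dest: subsetD[OF keys_cmul])
  have "frag_cmul (n e) (path_bd G' (initial_path e (t e))) =
      frag_cmul (n e) (frag_of (Interior e (t e)) - frag_of (Vertex (tail G e)))" if e: "e \<in> arcs G" for e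
  proof (cases "n e = 0")
    case False
    have "point_at G len e (t e) = Interior e (t e)"
      using nt[OF e] by (simp add: point_at_def)
    then show ?thesis
      using path_bd_initial_path[OF e t_div[OF e False]] by simp
  qed simp
  then have bd: "path_bd G' \<gamma> = D"
    by (simp add: \<gamma>_def D_def path_bd_sum path_bd_cmul)
  have "push_forward (period_vector refine_len \<gamma>) e = x e" if e: "e \<in> arcs G" for e
  proof -
    have "Poly_Mapping.lookup \<gamma> (e, a, b) = (if b \<le> t e then n e else 0)" if "(a, b) \<in> segments e" for a b
    proof -
      have "Poly_Mapping.lookup \<gamma> (e, a, b) = (\<Sum>e'\<in>arcs G. if e' = e then (if b \<le> t e then n e else 0) else 0)"
        unfolding \<gamma>_def lookup_sum using that by (intro sum.cong refl) (auto simp: lookup_initial_path)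
      then show ?thesis
        using e by simp
    qed
    then have "push_forward (period_vector refine_len \<gamma>) e = (\<Sum>(a, b)\<in>segments e. if b \<le> t e then of_int (n e) * (b - a) else 0)"
      unfolding push_forward_def by (intro sum.cong refl) (auto simp: refine_len_def)
    also have "\<dots> = (\<Sum>(a, b) | (a, b) \<in> segments e \<and> b \<le> t e. of_int (n e) * (b - a))"
      unfolding case_prod_unfold
      by (subst sum.inter_filter[symmetric]) (auto simp: finite_consecutive finite_division_points)
    also have "\<dots> = of_int (n e) * (\<Sum>(a, b) | (a, b) \<in> segments e \<and> b \<le> t e. b - a)"
      by (simp add: sum_distrib_left case_prod_unfold)
    also have "\<dots> = of_int (n e) * t e"
      using sum_initial_segments_telescope[OF e t_div[OF e], of "\<lambda>t. t"] by (cases "n e = 0") simp_all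
    also have "\<dots> = x e"
      using nt[OF e] by blast
    finally show ?thesis .
  qed
  then have "classical_AJ G len D = c"
    unfolding x classical_AJ_eq[OF refl \<gamma> bd] by (intro arg_cong[of _ _ "Jac_class G len"] functional_cong)
  with D show ?thesis ..
qed

theorem theorem5p1:
  fixes G :: "('v,'e) pre_digraph" and len :: "'e \<Rightarrow> real" and g :: nat
  assumes "tropical_curve G len"
    and "genus G = g"
    and "\<forall>e\<in>arcs G. \<not> separating_edge G e"
  shows "\<exists>!\<phi>. \<phi> \<in> extensional (carrier (Jac G len)) \<and>
           \<phi> \<in> iso (Jac G len) (JH10 G len) \<and>
           homeomorphic_map (Jac_topology G len) (JH10_topology G len) \<phi> \<and>
           (\<forall>D\<in>Div0 G len. \<phi> (classical_AJ G len D) = AJ G len D)"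
proof -
  have cc: "chain_connected G"
    using assms(1) by (rule chain_connected_if_tropical_curve)
  have pos: "\<forall>e\<in>arcs G. 0 < len e"
    using assms(1) by (simp add: tropical_curve_def)
  interpret chain_connected G
    by (rule cc)
  show ?thesis
  proof (intro ex1I[of _ "Jac_to_JH10 len"] conjI ballI)
    show "Jac_to_JH10 len \<in> extensional (carrier (Jac G len))"
      by (simp add: Jac_to_JH10_def)
    show "Jac_to_JH10 len (classical_AJ G len D) = AJ G len D" if "D \<in> Div0 G len" for D
      by (rule Jac_to_JH10_classical_AJ[OF cc pos that])
  next
    fix \<phi>
    assume \<phi>: "\<phi> \<in> extensional (carrier (Jac G len)) \<and>
           \<phi> \<in> iso (Jac G len) (JH10 G len) \<and>
           homeomorphic_map (Jac_topology G len) (JH10_topology G len) \<phi> \<and>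
           (\<forall>D\<in>Div0 G len. \<phi> (classical_AJ G len D) = AJ G len D)"
    show "\<phi> = Jac_to_JH10 len"
    proof (rule extensionalityI[of _ "carrier (Jac G len)"])
      fix c assume "c \<in> carrier (Jac G len)"
      then obtain D where "D \<in> Div0 G len" "classical_AJ G len D = c"
        using classical_AJ_surj[OF cc pos] by blast
      then show "\<phi> c = Jac_to_JH10 len c"
        using \<phi> Jac_to_JH10_classical_AJ[OF cc pos] by metis
    qed (use \<phi> in \<open>simp_all add: Jac_to_JH10_def\<close>)
  qed (rule Jac_to_JH10_iso homeomorphic_map_Jac_to_JH10)+
qed

end
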